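(* Let $s\ge 2$ and let $F$ be a finite linear $s$-uniform hypergraph whose line graph is a cograph. (Join node.) Suppose the line graph of $F$ is connected and $|E(F)|\ge 2$, with co-components $F_1,\dots,F_p$ ($p\ge2$). Let $m_i=|F_i|$, let $\mathcal B$ be the set of balanced indices, $z=|\mathcal B|$, and $a=|\{i\in\mathcal B:m_i=s\}|$. Then $$R_s(F)=\begin{cases}\displaystyle\sum_{i=1}^pR_s(F_i),& z\le 1,\\[2mm] \displaystyle\sum_{i\notin\mathcal B}R_s(F_i)+J_s(F),& z\ge2,\end{cases}$$ where $$J_s(F)=\sum_{i\in\mathcal B}m_i-(s+1)(z-1)=s+1-z+\sum_{i\in\mathcal B}(m_i-s).$$ Moreover $$J_s(F)\ge s+1-a\ge 0.$$ (Disjoint-union node.) If the line graph of $F$ is disconnected, $R_s(F)$ is the sum of $R_s$ over the subfamilies of edges forming the connected components of the line graph.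
   Context: A hypergraph is $s$-uniform if every edge has exactly $s$ vertices, and linear if any two distinct edges share at most one vertex. The line graph has the edges as vertices, two distinct edges being adjacent when they intersect. A cograph is a graph with no induced path on four vertices; the complement of a connected cograph with at least two vertices is disconnected. $N(F)$ is the edge--vertex incidence matrix (rows indexed by edges), and for an edge family $F$, $R_s(F)=(s+1)\operatorname{rank}_{\mathbb R}N(F)-s|F|$. Co-components: if the line graph $G$ of $F$ is connected with at least two vertices, the co-components $F_1,\dots,F_p$ are the subfamilies of edges forming the connected components of the complement $\overline G$; every edge of $F_i$ meets every edge of $F_j$ for $i\ne j$. Balanced: let $x_e\in\{0,1\}^{V}$ be the incidence vector of $e$, $\mathcal D_i=\operatorname{span}\{x_e-x_f:e,f\in F_i\}$, $\mathcal D=\mathcal D_1+\cdots+\mathcal D_p$. For $e\in F_i$ let $c_i$ be the orthogonal projection of $x_e$ onto $\mathcal D^\perp$ (it does not depend on the choice of $e\in F_i$). The index $i$ (or co-component $F_i$) is balanced if $\|c_i\|^2=1$. *)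

theory Defs
  imports "HOL-Analysis.Analysis"
begin

text \<open>
  A finite simple graph is given by a vertex set \<open>V\<close> and a symmetric irreflexive adjacency
  relation \<open>A \<subseteq> V \<times> V\<close>.
\<close>

definition graph_complement :: "'a set \<Rightarrow> 'a rel \<Rightarrow> 'a rel" where
  "graph_complement V A = {(u, v). u \<in> V \<and> v \<in> V \<and> u \<noteq> v \<and> (u, v) \<notin> A}"

definition graph_connected :: "'a set \<Rightarrow> 'a rel \<Rightarrow> bool" where
  "graph_connected V A \<longleftrightarrow> V \<noteq> {} \<and> (\<forall>u\<in>V. \<forall>v\<in>V. (u, v) \<in> A\<^sup>*)"

definition graph_components :: "'a set \<Rightarrow> 'a rel \<Rightarrow> 'a set set" where
  "graph_components V A = V // A\<^sup>*"

definition cograph :: "'a set \<Rightarrow> 'a rel \<Rightarrow> bool" where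
  "cograph V A \<longleftrightarrow>
     \<not> (\<exists>a\<in>V. \<exists>b\<in>V. \<exists>c\<in>V. \<exists>d\<in>V. distinct [a, b, c, d] \<and>
          (a, b) \<in> A \<and> (b, c) \<in> A \<and> (c, d) \<in> A \<and>
          (a, c) \<notin> A \<and> (a, d) \<notin> A \<and> (b, d) \<notin> A)"

text \<open>
  The vertices of a hypergraph are the elements of the finite type \<open>'v\<close>, and a hypergraph is
  identified with its (automatically finite) set of edges. Repeated edges need not be
  represented: two of them would share \<open>s \<ge> 2\<close> vertices, against linearity.
\<close>

definition uniform_hypergraph :: "nat \<Rightarrow> 'v set set \<Rightarrow> bool" where
  "uniform_hypergraph s F \<longleftrightarrow> (\<forall>e\<in>F. card e = s)"

definition linear_hypergraph :: "'v set set \<Rightarrow> bool" where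
  "linear_hypergraph F \<longleftrightarrow> (\<forall>e\<in>F. \<forall>f\<in>F. e \<noteq> f \<longrightarrow> card (e \<inter> f) \<le> 1)"

text \<open>Adjacency relation of the line graph, whose vertex set is \<open>F\<close>.\<close>

definition line_graph :: "'v set set \<Rightarrow> 'v set rel" where
  "line_graph F = {(e, f). e \<in> F \<and> f \<in> F \<and> e \<noteq> f \<and> e \<inter> f \<noteq> {}}"

definition line_components :: "'v set set \<Rightarrow> 'v set set set" where
  "line_components F = graph_components F (line_graph F)"

definition cocomponents :: "'v set set \<Rightarrow> 'v set set set" where
  "cocomponents F = graph_components F (graph_complement F (line_graph F))"

definition incidence_vec :: "'v set \<Rightarrow> real ^ 'v::finite" where
  "incidence_vec e = (\<chi> v. if v \<in> e then 1 else 0)"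

text \<open>
  So that the incidence matrices of all edge families over the same vertices have one type, the
  rows are indexed by all sets of vertices. The rows of non-edges are zero and do not
  affect the rank.
\<close>

definition incidence_matrix :: "'v set set \<Rightarrow> real ^ 'v ^ ('v::finite set)" where
  "incidence_matrix F = (\<chi> e v. if e \<in> F \<and> v \<in> e then 1 else 0)"

lemma rank_incidence_matrix: "rank (incidence_matrix F) = dim (incidence_vec ` F)"
proof -
  have row: "row e (incidence_matrix F) = (if e \<in> F then incidence_vec e else 0)" for e
    by (simp add: row_def incidence_matrix_def incidence_vec_def vec_eq_iff)
  have "rows (incidence_matrix F) - {0} = incidence_vec ` F - {0}"
    by (auto simp: rows_def row split: if_splits)
  then have "span (rows (incidence_matrix F)) = span (incidence_vec ` F)"
    by (metis span_delete_0)
  then show ?thesis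
    unfolding row_rank_def by (metis dim_span)
qed

definition R :: "nat \<Rightarrow> 'v::finite set set \<Rightarrow> int" where
  "R s F = (int s + 1) * int (rank (incidence_matrix F)) - int s * int (card F)"

definition orth_proj :: "'a::euclidean_space set \<Rightarrow> 'a \<Rightarrow> 'a" where
  "orth_proj W x = (THE y. y \<in> W \<and> x - y \<in> W\<^sup>\<bottom>)"

lemma orth_proj_eqI:
  assumes "subspace W" "y \<in> W" "x - y \<in> W\<^sup>\<bottom>"
  shows "orth_proj W x = y"
  unfolding orth_proj_def
proof (rule the_equality)
  fix z assume z: "z \<in> W \<and> x - z \<in> W\<^sup>\<bottom>"
  have "y - z \<in> W" using assms z by (simp add: subspace_diff)
  moreover have "y - z \<in> W\<^sup>\<bottom>"
    using subspace_diff[OF subspace_orthogonal_comp, of "x - z" W "x - y"] assms z by simp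
  ultimately have "orthogonal (y - z) (y - z)" by (simp add: orthogonal_comp_def)
  then show "z = y" by (simp add: orthogonal_self)
qed (use assms in auto)

lemma orth_proj:
  assumes "subspace W"
  shows "orth_proj W x \<in> W" and "x - orth_proj W x \<in> W\<^sup>\<bottom>"
proof -
  obtain y z where "y \<in> W" "z \<in> W\<^sup>\<bottom>" "x = y + z"
    using subspace_sum_orthogonal_comp[OF assms] set_plus_elim by (metis UNIV_I)
  then have "y \<in> W" "x - y \<in> W\<^sup>\<bottom>" by auto
  then show "orth_proj W x \<in> W" "x - orth_proj W x \<in> W\<^sup>\<bottom>"
    using orth_proj_eqI[OF assms] by auto
qed

definition diff_space :: "'v set set \<Rightarrow> (real ^ 'v::finite) set" where
  "diff_space C = span {incidence_vec e - incidence_vec f |e f. e \<in> C \<and> f \<in> C}"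

text \<open>The sum below is the sum of subspaces, i.e. the Minkowski sum of sets.\<close>

definition total_diff_space :: "'v set set \<Rightarrow> (real ^ 'v::finite) set" where
  "total_diff_space F = (\<Sum>C\<in>cocomponents F. diff_space C)"

definition center :: "'v set set \<Rightarrow> 'v set set \<Rightarrow> real ^ 'v::finite" where
  "center F C = orth_proj ((total_diff_space F)\<^sup>\<bottom>) (incidence_vec (SOME e. e \<in> C))"

lemma subspace_total_diff_space: "subspace (total_diff_space F)"
proof -
  have "subspace (\<Sum>C\<in>S. diff_space C)" if "finite S" for S :: "'a::finite set set set"
    using that
  proof induction
    case empty
    then show ?case by (simp add: set_zero)
  next
    case (insert C S)
    then show ?case
      using subspace_sums[of "diff_space C" "\<Sum>C\<in>S. diff_space C"]
      by (simp add: set_plus_def diff_space_def Bex_def conj_ac)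
         (smt (verit) Collect_cong)
  qed
  then show ?thesis unfolding total_diff_space_def by simp
qed

lemma diff_space_subset_total:
  assumes "C \<in> cocomponents F"
  shows "diff_space C \<subseteq> total_diff_space F"
proof
  fix x assume x: "x \<in> diff_space C"
  have "(\<Sum>D\<in>cocomponents F. if D = C then x else 0) \<in> total_diff_space F"
    unfolding total_diff_space_def
    by (subst set_sum_alt)
       (use x in \<open>auto simp: diff_space_def span_zero
          intro!: exI[of _ "\<lambda>D. if D = C then x else 0"]\<close>)
  then show "x \<in> total_diff_space F" using assms by simp
qed

lemma center_eq:
  assumes C: "C \<in> cocomponents F" and e: "e \<in> C"
  shows "center F C = orth_proj ((total_diff_space F)\<^sup>\<bottom>) (incidence_vec e)"
proof -
  define W where "W = (total_diff_space F)\<^sup>\<bottom>"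
  define f where "f = (SOME e. e \<in> C)"
  have W: "subspace W" by (simp add: W_def subspace_orthogonal_comp)
  have "f \<in> C" unfolding f_def using e by (rule someI)
  then have "incidence_vec f - incidence_vec e \<in> diff_space C"
    unfolding diff_space_def using e by (intro span_base) blast
  then have "incidence_vec f - incidence_vec e \<in> W\<^sup>\<bottom>"
    using diff_space_subset_total[OF C] orthogonal_comp_subset unfolding W_def by blast
  moreover note orth_proj(2)[OF W, of "incidence_vec e"]
  ultimately have "(incidence_vec f - incidence_vec e) +
      (incidence_vec e - orth_proj W (incidence_vec e)) \<in> W\<^sup>\<bottom>"
    by (rule subspace_add[OF subspace_orthogonal_comp])
  then have "orth_proj W (incidence_vec f) = orth_proj W (incidence_vec e)"
    by (intro orth_proj_eqI W orth_proj(1)) simp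
  then show ?thesis by (simp add: center_def W_def f_def)
qed

definition balanced :: "'v::finite set set \<Rightarrow> 'v set set \<Rightarrow> bool" where
  "balanced F C \<longleftrightarrow> (norm (center F C))\<^sup>2 = 1"

definition balanced_cocomponents :: "'v::finite set set \<Rightarrow> 'v set set set" where
  "balanced_cocomponents F = {C \<in> cocomponents F. balanced F C}"

definition J :: "nat \<Rightarrow> 'v::finite set set \<Rightarrow> int" where
  "J s F = (\<Sum>C\<in>balanced_cocomponents F. int (card C))
             - (int s + 1) * (int (card (balanced_cocomponents F)) - 1)"

end

theory Submission
  imports Defs
begin

text \<open>
  Let \<open>u\<^sub>1 + \<dots> + u\<^sub>p = 0\<close> with \<open>u\<^sub>i\<close> a combination of the edges of \<open>F\<^sub>i\<close> of total weight \<open>w\<^sub>i\<close>.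
  Summing coordinates gives \<open>w\<^sub>1 + \<dots> + w\<^sub>p = 0\<close>, and since edges of different co-components
  meet in one point, \<open>u\<^sub>i\<close> has inner product \<open>w\<^sub>i\<close> with every edge of \<open>F\<^sub>i\<close>. So if \<open>w\<^sub>i \<noteq> 0\<close>, then
  \<open>u\<^sub>i = w\<^sub>i c\<^sub>i\<close> and \<open>\<parallel>c\<^sub>i\<parallel> = 1\<close>: only balanced co-components take part in dependencies. All balanced
  co-components have the same centre, so the span of \<open>F\<close> loses exactly \<open>z - 1\<close> dimensions.

  A balanced co-component is a disjoint union of two families whose affine hulls stay at
  distance more than \<open>1\<close> from \<open>0\<close>. By induction along the cotree such a family is linearly
  independent, and the all-ones system of its Gram matrix has a nonnegative solution. So the
  centre of a balanced \<open>F\<^sub>i\<close> is a convex combination of its edges in which each weight is at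
  most \<open>1/s\<close>. This gives \<open>m\<^sub>i \<ge> s\<close>, and \<open>m\<^sub>i = s\<close> forces the edges of \<open>F\<^sub>i\<close> to be disjoint.
\<close>

section \<open>Splitting cographs\<close>

lemma cograph_subset: "cograph V A \<Longrightarrow> W \<subseteq> V \<Longrightarrow> cograph W A"
  unfolding cograph_def by (meson subsetD)

text \<open>The path on four vertices is self-complementary: an induced path \<open>a\<close>,
  \<open>b\<close>, \<open>c\<close>, \<open>d\<close> of the complement is the induced path
  \<open>c\<close>, \<open>a\<close>, \<open>d\<close>, \<open>b\<close> of
  \<open>A\<close>.\<close>

lemma cograph_complement:
  assumes "sym A" "cograph V A"
  shows "cograph V (graph_complement V A)"
  unfolding cograph_def
proof (clarify)
  fix a b c d
  assume V: "a \<in> V" "b \<in> V" "c \<in> V" "d \<in> V" and d: "distinct [a, b, c, d]"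
    and e: "(a, b) \<in> graph_complement V A" "(b, c) \<in> graph_complement V A"
      "(c, d) \<in> graph_complement V A" "(a, c) \<notin> graph_complement V A"
      "(a, d) \<notin> graph_complement V A" "(b, d) \<notin> graph_complement V A"
  have "(c, a) \<in> A" "(a, d) \<in> A" "(d, b) \<in> A" "(c, d) \<notin> A" "(c, b) \<notin> A" "(a, b) \<notin> A"
    using V d e \<open>sym A\<close> by (auto simp: graph_complement_def dest: symD)
  moreover have "distinct [c, a, d, b]" using d by auto
  ultimately show False using assms(2) V unfolding cograph_def by blast
qed

text \<open>A witness of disconnectedness; for \<open>graph_complement V A\<close> it is a witness
  that the graph is a join. \<open>A\<close> may contain pairs outside \<open>V\<close>, so one
  relation serves all induced subgraphs.\<close>

definition splits :: "'a set \<Rightarrow> 'a rel \<Rightarrow> 'a set \<Rightarrow> 'a set \<Rightarrow> bool" where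
  "splits V A X Y \<longleftrightarrow> X \<noteq> {} \<and> Y \<noteq> {} \<and> X \<inter> Y = {} \<and> X \<union> Y = V \<and>
     (\<forall>x\<in>X. \<forall>y\<in>Y. (x, y) \<notin> A)"

text \<open>If \<open>v\<close> is adjacent to all of \<open>W\<close>, it splits off in the
  complement. Otherwise let \<open>S\<close> be the component, inside \<open>W\<close>, of a
  non-neighbour \<open>b\<close> of \<open>v\<close>. Without a neighbour of \<open>v\<close> in
  \<open>S\<close>, the set \<open>S\<close> splits off. With one, \<open>v\<close> has no neighbour
  on the side of the old split not containing \<open>b\<close>, and that side splits off.\<close>

lemma split_insert:
  assumes "sym A" and cg: "cograph (insert v W) A" and v: "v \<notin> W"
    and sp: "splits W A X Y"
  shows "\<exists>X Y. splits (insert v W) A X Y \<or> splits (insert v W) (graph_complement (insert v W) A) X Y"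
proof (cases "\<forall>w\<in>W. (v, w) \<in> A")
  case True
  then have "splits (insert v W) (graph_complement (insert v W) A) {v} W"
    using sp v by (auto simp: splits_def graph_complement_def)
  then show ?thesis by blast
next
  case False
  then obtain b where b: "b \<in> W" "(v, b) \<notin> A" by blast
  obtain X Y where sp: "splits W A X Y" and bX: "b \<in> X"
  proof (cases "b \<in> X")
    case True
    then show ?thesis using that sp by blast
  next
    case False
    then have "splits W A Y X" "b \<in> Y" using sp b \<open>sym A\<close> by (auto simp: splits_def dest: symD)
    then show ?thesis using that by blast
  qed
  define E where "E = A \<inter> W \<times> W"
  define S where "S = E\<^sup>* `` {b}"
  have SX: "S \<subseteq> X"
  proof
    fix x assume "x \<in> S"
    then have "(b, x) \<in> E\<^sup>*" by (simp add: S_def)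
    then show "x \<in> X"
      by induction (use bX sp in \<open>auto simp: splits_def E_def\<close>)
  qed
  have bS: "b \<in> S" by (simp add: S_def)
  show ?thesis
  proof (cases "\<exists>a\<in>S. (v, a) \<in> A")
    case True
    then obtain a where a: "(b, a) \<in> E\<^sup>*" "(v, a) \<in> A" by (auto simp: S_def)
    \<comment> \<open>Some edge on a walk from \<open>b\<close> to \<open>a\<close> leads from a
      non-neighbour of \<open>v\<close> to a neighbour.\<close>
    have "\<exists>b' a'. (b, b') \<in> E\<^sup>* \<and> (b', a') \<in> E \<and> (v, b') \<notin> A \<and> (v, a') \<in> A"
      using a by (induction rule: rtrancl_induct) (use b in blast)+
    then obtain b' a' where ba: "(b, b') \<in> E\<^sup>*" "(b', a') \<in> E" "(v, b') \<notin> A" "(v, a') \<in> A" by blast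
    have bX': "b' \<in> X" "a' \<in> X" using SX ba unfolding S_def by (auto intro: rtrancl_into_rtrancl)
    \<comment> \<open>Otherwise \<open>u\<close>, \<open>v\<close>, \<open>a'\<close>,
      \<open>b'\<close> is an induced path, since the split separates \<open>u\<close> from
      \<open>a'\<close> and \<open>b'\<close>.\<close>
    have "(v, u) \<notin> A" if u: "u \<in> Y" for u
    proof
      assume "(v, u) \<in> A"
      have "(u, v) \<in> A" "(a', b') \<in> A" "(u, a') \<notin> A" "(u, b') \<notin> A" "distinct [u, v, a', b']"
        "u \<in> W" "a' \<in> W" "b' \<in> W"
        using \<open>(v, u) \<in> A\<close> ba bX' u sp \<open>sym A\<close> v unfolding splits_def E_def
        by (auto dest: symD)
      then show False using cg ba(3,4) unfolding cograph_def by blast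
    qed
    then have "splits (insert v W) A (insert v X) Y"
      using sp v by (auto simp: splits_def)
    then show ?thesis by blast
  next
    case False
    have "splits (insert v W) A S (insert v W - S)"
      unfolding splits_def
    proof (intro conjI ballI)
      fix x y assume x: "x \<in> S" and y: "y \<in> insert v W - S"
      show "(x, y) \<notin> A"
      proof
        assume xy: "(x, y) \<in> A"
        have "y \<noteq> v" using False x xy \<open>sym A\<close> by (auto dest: symD)
        moreover have "x \<in> W" using SX x sp by (auto simp: splits_def)
        ultimately have "(x, y) \<in> E" using xy y by (auto simp: E_def)
        then have "y \<in> S" using x by (auto simp: S_def intro: rtrancl_into_rtrancl)
        then show False using y by simp
      qed
    qed (use bS SX sp v in \<open>auto simp: splits_def\<close>)
    then show ?thesis by blast
  qed
qed

lemma sym_graph_complement: "sym A \<Longrightarrow> sym (graph_complement V A)"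
  by (auto simp: graph_complement_def sym_def)

text \<open>Seinsche's theorem.\<close>

lemma cograph_split:
  assumes "finite V" "card V \<ge> 2" "sym A" "cograph V A"
  shows "\<exists>X Y. splits V A X Y \<or> splits V (graph_complement V A) X Y"
  using assms
proof (induction V rule: finite_induct)
  case (insert v W)
  let ?V = "insert v W"
  show ?case
  proof (cases "card W \<ge> 2")
    case True
    have "cograph W A" using insert.prems cograph_subset by blast
    then obtain X Y where "splits W A X Y \<or> splits W (graph_complement W A) X Y"
      using insert True by blast
    then show ?thesis
    proof
      assume "splits W A X Y"
      then show ?thesis using split_insert insert by metis
    next
      \<comment> \<open>The one-vertex extension is applied to the complement, again a cograph;
        between disjoint sets the double complement agrees with \<open>A\<close>.\<close>
      assume "splits W (graph_complement W A) X Y"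
      moreover have "W \<subseteq> ?V" by blast
      ultimately have "splits W (graph_complement ?V A) X Y"
        by (auto simp: splits_def graph_complement_def)
      from split_insert[OF sym_graph_complement cograph_complement insert.hyps(2) this]
      obtain X' Y' where "splits ?V (graph_complement ?V A) X' Y' \<or>
          splits ?V (graph_complement ?V (graph_complement ?V A)) X' Y'"
        using insert.prems by blast
      moreover have "splits ?V A X' Y'"
        if "splits ?V (graph_complement ?V (graph_complement ?V A)) X' Y'"
        using that unfolding splits_def graph_complement_def by blast
      ultimately show ?thesis by blast
    qed
  next
    case False
    then have "card W = 1" using insert by auto
    then obtain w where "W = {w}" by (auto simp: card_1_singleton_iff)
    then have "splits ?V A {v} {w} \<or> splits ?V (graph_complement ?V A) {v} {w}"
      using insert.hyps by (auto simp: splits_def graph_complement_def)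
    then show ?thesis by blast
  qed
qed simp

section \<open>Connectivity, components and co-components\<close>

lemma splits_not_connected:
  assumes "splits V A X Y" shows "\<not> graph_connected V (A \<inter> V \<times> V)"
proof
  assume c: "graph_connected V (A \<inter> V \<times> V)"
  obtain x y where xy: "x \<in> X" "y \<in> Y" using assms by (auto simp: splits_def)
  then have "(x, y) \<in> (A \<inter> V \<times> V)\<^sup>*"
    using c assms by (auto simp: graph_connected_def splits_def)
  then have "y \<in> X"
    by induction (use xy assms in \<open>auto simp: splits_def\<close>)
  then show False using xy assms by (auto simp: splits_def)
qed

lemma graph_components_partition:
  assumes "sym A" "A \<subseteq> V \<times> V"
  shows "\<Union>(graph_components V A) = V"
    and "C \<in> graph_components V A \<Longrightarrow> C \<noteq> {}"
    and "C \<in> graph_components V A \<Longrightarrow> D \<in> graph_components V A \<Longrightarrow> C \<noteq> D \<Longrightarrow> C \<inter> D = {}"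
    and "C \<in> graph_components V A \<Longrightarrow> D \<in> graph_components V A \<Longrightarrow> C \<noteq> D \<Longrightarrow>
      x \<in> C \<Longrightarrow> y \<in> D \<Longrightarrow> (x, y) \<notin> A"
    and "C \<in> graph_components V A \<Longrightarrow> graph_connected C (A \<inter> C \<times> C)"
proof -
  have sub: "A\<^sup>* `` {x} \<subseteq> V" if "x \<in> V" for x
  proof
    fix y assume "y \<in> A\<^sup>* `` {x}"
    then have "(x, y) \<in> A\<^sup>*" by simp
    then show "y \<in> V" by induction (use that assms in auto)
  qed
  have sy: "(y, x) \<in> A\<^sup>*" if "(x, y) \<in> A\<^sup>*" for x y
    using sym_rtrancl[OF assms(1)] that by (rule symD)
  show "\<Union>(graph_components V A) = V"
    using sub by (auto simp: graph_components_def quotient_def)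
  show ne: "C \<in> graph_components V A \<Longrightarrow> C \<noteq> {}"
    by (auto simp: graph_components_def quotient_def)
  have mem: "C = A\<^sup>* `` {x}" if C: "C \<in> graph_components V A" and x: "x \<in> C" for x C
    using C x sy unfolding graph_components_def quotient_def
    by (auto intro: rtrancl_trans)
  show "C \<in> graph_components V A \<Longrightarrow> D \<in> graph_components V A \<Longrightarrow> C \<noteq> D \<Longrightarrow> C \<inter> D = {}"
    using mem by blast
  show "C \<in> graph_components V A \<Longrightarrow> D \<in> graph_components V A \<Longrightarrow> C \<noteq> D \<Longrightarrow>
      x \<in> C \<Longrightarrow> y \<in> D \<Longrightarrow> (x, y) \<notin> A"
    using mem by blast
  show "graph_connected C (A \<inter> C \<times> C)" if C: "C \<in> graph_components V A"
    unfolding graph_connected_def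
  proof (intro conjI ballI)
    fix x y assume x: "x \<in> C" and y: "y \<in> C"
    then have "(x, y) \<in> A\<^sup>*" using mem[OF C x] by auto
    then show "(x, y) \<in> (A \<inter> C \<times> C)\<^sup>*"
    proof induction
      case (step y z)
      then have "y \<in> C" "z \<in> C" using mem[OF C x] by (auto intro: rtrancl_into_rtrancl)
      then have "(y, z) \<in> A \<inter> C \<times> C" using step by blast
      with step.IH show ?case by (rule rtrancl_into_rtrancl)
    qed simp
  qed (use ne C in auto)
qed

lemma sym_line_graph: "sym (line_graph F)"
  by (auto simp: line_graph_def sym_def)

lemma line_graph_subset: "C \<subseteq> F \<Longrightarrow> line_graph C = line_graph F \<inter> C \<times> C"
  by (auto simp: line_graph_def)

lemma complement_line_graph_subset:
  "C \<subseteq> F \<Longrightarrow> graph_complement C (line_graph C) = graph_complement F (line_graph F) \<inter> C \<times> C"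
  by (auto simp: graph_complement_def line_graph_def)

lemma cograph_line_graph_subset:
  "cograph F (line_graph F) \<Longrightarrow> C \<subseteq> F \<Longrightarrow> cograph C (line_graph C)"
  using cograph_subset[of F "line_graph F" C] unfolding cograph_def line_graph_subset by blast

lemma line_graph_Times: "line_graph F \<subseteq> F \<times> F"
  by (auto simp: line_graph_def)

lemma graph_complement_Times: "graph_complement V A \<subseteq> V \<times> V"
  by (auto simp: graph_complement_def)

lemmas line_components_partition =
  graph_components_partition[OF sym_line_graph line_graph_Times, folded line_components_def]

lemmas cocomponents_partition =
  graph_components_partition[where V = F and A = "graph_complement F (line_graph F)" for F,
    OF sym_graph_complement[OF sym_line_graph] graph_complement_Times, folded cocomponents_def]

section \<open>Combinations of incidence vectors\<close>

text \<open>Coefficients are indexed by edges rather than by vectors, so that passing to subfamilies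
  and unions needs no reindexing; values outside \<open>A\<close> do not matter.\<close>

definition comb :: "('v set \<Rightarrow> real) \<Rightarrow> 'v::finite set set \<Rightarrow> real ^ 'v" where
  "comb l A = (\<Sum>e\<in>A. l e *\<^sub>R incidence_vec e)"

lemma inner_incidence_vec: "incidence_vec e \<bullet> incidence_vec f = real (card (e \<inter> f))"
proof -
  have "incidence_vec e \<bullet> incidence_vec f = (\<Sum>v\<in>UNIV. if v \<in> e \<inter> f then 1 else 0)"
    unfolding incidence_vec_def inner_vec_def by (intro sum.cong) auto
  then show ?thesis by (simp add: sum.If_cases Int_def)
qed

lemma inj_incidence_vec: "inj incidence_vec"
proof (rule injI)
  fix e f :: "'v::finite set" assume *: "incidence_vec e = incidence_vec f"
  have "v \<in> e \<longleftrightarrow> v \<in> f" for v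
    using arg_cong[OF *, of "\<lambda>x. x $ v"] by (auto simp: incidence_vec_def split: if_splits)
  then show "e = f" by blast
qed

lemma comb_inner: "comb l A \<bullet> x = (\<Sum>e\<in>A. l e * (incidence_vec e \<bullet> x))"
  by (simp add: comb_def inner_sum_left)

text \<open>Often used with \<open>x\<close> equal to the combination itself, where it turns
  constant inner products with the edges into a squared norm.\<close>

lemma comb_inner_const:
  assumes "\<And>e. e \<in> A \<Longrightarrow> x \<bullet> incidence_vec e = k"
  shows "x \<bullet> comb l A = k * sum l A"
proof -
  have "x \<bullet> comb l A = (\<Sum>e\<in>A. l e * (x \<bullet> incidence_vec e))"
    by (simp add: comb_def inner_sum_right)
  also have "\<dots> = (\<Sum>e\<in>A. k * l e)"
    using assms by (intro sum.cong) (auto simp: mult.commute)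
  finally show ?thesis by (simp add: sum_distrib_left)
qed

lemma comb_add: "comb (\<lambda>e. l e + m e) A = comb l A + comb m A"
  by (simp add: comb_def scaleR_add_left sum.distrib)

lemma comb_scale: "comb (\<lambda>e. k * l e) A = k *\<^sub>R comb l A"
  by (simp add: comb_def scaleR_sum_right)

lemma comb_diff: "comb (\<lambda>e. l e - m e) A = comb l A - comb m A"
  by (simp add: comb_def scaleR_diff_left sum_subtractf)

lemma comb_subset:
  "B \<subseteq> A \<Longrightarrow> comb (\<lambda>e. if e \<in> B then l e else 0) A = comb l B"
  unfolding comb_def by (rule sum.mono_neutral_cong_right) auto

lemma sum_subset_if:
  "B \<subseteq> A \<Longrightarrow> sum (\<lambda>e. if e \<in> B then l e else (0::real)) A = sum l (B :: 'v::finite set set)"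
  by (rule sum.mono_neutral_cong_right) auto

lemma comb_Un: "A \<inter> B = {} \<Longrightarrow> comb l (A \<union> B) = comb l A + comb l B"
  unfolding comb_def by (rule sum.union_disjoint) auto

lemma comb_single: "e \<in> A \<Longrightarrow> comb (\<lambda>f. if f = e then 1 else 0) A = incidence_vec e"
  using comb_subset[of "{e}" A "\<lambda>_. 1"] by (simp add: comb_def)

lemma comb_cong: "(\<And>e. e \<in> A \<Longrightarrow> l e = m e) \<Longrightarrow> comb l A = comb m A"
  unfolding comb_def by (rule sum.cong) auto

text \<open>The vector of \<open>UNIV\<close> is the all-ones vector, so this sums coordinates and
  recovers the total weight from the vector.\<close>

lemma comb_inner_UNIV:
  assumes "uniform_hypergraph s A"
  shows "comb l A \<bullet> incidence_vec UNIV = real s * sum l A"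
  using assms by (simp add: comb_inner inner_incidence_vec uniform_hypergraph_def
      sum_distrib_left mult.commute)

lemma span_incidence: "span (incidence_vec ` A) = range (\<lambda>l. comb l A)"
proof -
  have "span (incidence_vec ` A) = range (\<lambda>u. \<Sum>e\<in>A. u (incidence_vec e) *\<^sub>R incidence_vec e)"
    by (subst span_finite) (simp_all add: sum.reindex inj_on_subset[OF inj_incidence_vec])
  also have "\<dots> = range (\<lambda>l. comb l A)"
  proof (intro equalityI subsetI; clarify)
    fix l :: "'a set \<Rightarrow> real"
    have "comb l A = (\<Sum>e\<in>A. (l \<circ> inv incidence_vec) (incidence_vec e) *\<^sub>R incidence_vec e)"
      by (simp add: comb_def inv_f_f[OF inj_incidence_vec])
    then show "comb l A \<in> range (\<lambda>u. \<Sum>e\<in>A. u (incidence_vec e) *\<^sub>R incidence_vec e)" by blast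
  qed (auto simp: comb_def)
  finally show ?thesis .
qed

definition independent_edges :: "'v::finite set set \<Rightarrow> bool" where
  "independent_edges A \<longleftrightarrow> (\<forall>l. comb l A = 0 \<longrightarrow> (\<forall>e\<in>A. l e = 0))"

lemma independent_edges_subset:
  assumes "independent_edges A" "B \<subseteq> A"
  shows "independent_edges B"
  unfolding independent_edges_def
proof (intro allI impI ballI)
  fix l e assume "comb l B = 0" and e: "e \<in> B"
  then have "comb (\<lambda>e. if e \<in> B then l e else 0) A = 0" using comb_subset[OF assms(2)] by metis
  then have "(if e \<in> B then l e else 0) = 0"
    using e assms unfolding independent_edges_def by blast
  then show "l e = 0" using e by simp
qed

lemma dim_independent_edges:
  assumes "independent_edges A"
  shows "dim (incidence_vec ` A) = card A"
proof -
  have "independent (incidence_vec ` A)"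
  proof (rule independent_if_scalars_zero)
    fix f x assume "(\<Sum>x\<in>incidence_vec ` A. f x *\<^sub>R x) = 0" "x \<in> incidence_vec ` A"
    moreover from this(1) have "comb (f \<circ> incidence_vec) A = 0"
      by (simp add: comb_def sum.reindex inj_on_subset[OF inj_incidence_vec])
    ultimately show "f x = 0"
      using assms unfolding independent_edges_def by fastforce
  qed simp
  then show ?thesis
    by (simp add: dim_eq_card_independent card_image inj_on_subset[OF inj_incidence_vec])
qed

lemma span_UN_sum:
  assumes "finite P" "x \<in> span (\<Union>a\<in>P. S a)"
  shows "\<exists>u. (\<forall>a\<in>P. u a \<in> span (S a)) \<and> x = sum u P"
  using assms
proof (induction P arbitrary: x rule: finite_induct)
  case (insert a P)
  then obtain y z where yz: "y \<in> span (S a)" "z \<in> span (\<Union>a\<in>P. S a)" "x = y + z"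
    by (auto simp: span_Un)
  with insert.IH obtain u where "\<forall>a\<in>P. u a \<in> span (S a)" "z = sum u P" by blast
  then have "(\<forall>b\<in>insert a P. (u(a := y)) b \<in> span (S b)) \<and> x = sum (u(a := y)) (insert a P)"
    using yz insert.hyps by (auto intro!: sum.cong)
  then show ?case by blast
qed simp

lemma dim_UN_independent:
  fixes S :: "'i \<Rightarrow> 'a::euclidean_space set"
  assumes "finite P"
    and "\<And>u. (\<And>a. a \<in> P \<Longrightarrow> u a \<in> span (S a)) \<Longrightarrow> sum u P = 0 \<Longrightarrow> \<forall>a\<in>P. u a = 0"
  shows "dim (\<Union>a\<in>P. S a) = (\<Sum>a\<in>P. dim (S a))"
  using assms
proof (induction P rule: finite_induct)
  case (insert a P)
  let ?U = "\<Union>a\<in>P. S a"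
  have "\<forall>b\<in>P. u b = 0" if u: "\<And>b. b \<in> P \<Longrightarrow> u b \<in> span (S b)" "sum u P = 0" for u
  proof -
    have "\<forall>b\<in>insert a P. (u(a := 0)) b = 0"
    proof (intro insert.prems)
      have "sum (u(a := 0)) P = sum u P" using insert.hyps by (intro sum.cong) auto
      then show "sum (u(a := 0)) (insert a P) = 0" using u(2) insert.hyps by simp
    qed (use u(1) in \<open>auto simp: span_zero\<close>)
    then show ?thesis using insert.hyps by (metis fun_upd_other insertCI)
  qed
  then have IH: "dim ?U = (\<Sum>a\<in>P. dim (S a))" using insert.IH by blast
  have "span (S a) \<inter> span ?U \<subseteq> {0}"
  proof
    fix x assume x: "x \<in> span (S a) \<inter> span ?U"
    then obtain u where u: "\<forall>b\<in>P. u b \<in> span (S b)" "x = sum u P"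
      using span_UN_sum[OF insert.hyps(1)] by blast
    \<comment> \<open>Placing \<open>- x\<close> at \<open>a\<close> turns a decomposition of
      \<open>x\<close> over \<open>P\<close> into a vanishing sum over
      \<open>insert a P\<close>.\<close>
    have "sum (u(a := - x)) P = sum u P" using insert.hyps by (intro sum.cong) auto
    then have "\<forall>b\<in>insert a P. (u(a := - x)) b = 0"
      using u x insert.hyps by (intro insert.prems) (auto simp: span_neg)
    then show "x \<in> {0}" by simp
  qed
  then have int: "span (S a) \<inter> span ?U = {0}" using span_zero by blast
  have "dim (S a \<union> ?U) = dim {x + y |x y. x \<in> span (S a) \<and> y \<in> span ?U}"
    by (simp only: dim_span flip: span_Un)
  also have "\<dots> = dim (S a) + dim ?U"
    using dim_sums_Int[OF subspace_span[of "S a"] subspace_span[of ?U]] int by simp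
  finally show ?case using insert.hyps IH by simp
qed simp

section \<open>Dependencies between cross-intersecting families\<close>

definition cross_intersecting :: "'v set set \<Rightarrow> 'v set set \<Rightarrow> bool" where
  "cross_intersecting A B \<longleftrightarrow> (\<forall>e\<in>A. \<forall>f\<in>B. card (e \<inter> f) = 1)"

lemma cross_inner:
  assumes "cross_intersecting A B" "f \<in> B"
  shows "comb l A \<bullet> incidence_vec f = sum l A"
  using assms by (simp add: comb_inner inner_incidence_vec cross_intersecting_def)

text \<open>Pairing the zero sum with the all-ones vector gives total weight 0. Pairing it with an
  edge of \<open>C\<close>, each other family contributes its weight, so together they give minus
  the weight of \<open>C\<close>, which the term of \<open>C\<close> must cancel. Combining over the
  edges of \<open>C\<close> gives the norm.\<close>

lemma join_dependency:
  assumes "s > 0" and P: "\<And>C. C \<in> P \<Longrightarrow> uniform_hypergraph s C"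
    and cross: "\<And>C D. C \<in> P \<Longrightarrow> D \<in> P \<Longrightarrow> C \<noteq> D \<Longrightarrow> cross_intersecting C D"
    and zero: "(\<Sum>C\<in>P. comb (l C) C) = 0"
  shows "(\<Sum>C\<in>P. sum (l C) C) = 0"
    and "C \<in> P \<Longrightarrow> e \<in> C \<Longrightarrow> comb (l C) C \<bullet> incidence_vec e = sum (l C) C"
    and "C \<in> P \<Longrightarrow> comb (l C) C \<bullet> comb (l C) C = (sum (l C) C)\<^sup>2"
proof -
  have "real s * (\<Sum>C\<in>P. sum (l C) C) = (\<Sum>C\<in>P. comb (l C) C \<bullet> incidence_vec UNIV)"
    using P by (subst sum_distrib_left) (intro sum.cong refl comb_inner_UNIV[symmetric])
  also have "\<dots> = 0" using zero by (simp flip: inner_sum_left)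
  finally show total: "(\<Sum>C\<in>P. sum (l C) C) = 0" using \<open>s > 0\<close> by simp
  show single: "comb (l C) C \<bullet> incidence_vec e = sum (l C) C" if C: "C \<in> P" and e: "e \<in> C" for C e
  proof -
    have "(\<Sum>D\<in>P - {C}. comb (l D) D \<bullet> incidence_vec e) = (\<Sum>D\<in>P - {C}. sum (l D) D)"
      using C e cross by (intro sum.cong refl cross_inner) auto
    moreover have "(\<Sum>D\<in>P. comb (l D) D \<bullet> incidence_vec e) = 0"
      using zero by (simp flip: inner_sum_left)
    ultimately show ?thesis
      using total C sum.remove[of P C "\<lambda>D. comb (l D) D \<bullet> incidence_vec e"]
        sum.remove[of P C "\<lambda>D. sum (l D) D"] by simp
  qed
  show "comb (l C) C \<bullet> comb (l C) C = (sum (l C) C)\<^sup>2" if "C \<in> P"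
    using comb_inner_const[OF single[OF that]] by (simp add: power2_eq_square)
qed

text \<open>The empty family qualifies vacuously, having no combination of weight 1.\<close>

definition long_affine_hull :: "'v::finite set set \<Rightarrow> bool" where
  "long_affine_hull A \<longleftrightarrow> (\<forall>l. sum l A = 1 \<longrightarrow> comb l A \<bullet> comb l A > 1)"

lemma long_affine_hull_subset:
  assumes "long_affine_hull A" "B \<subseteq> A" shows "long_affine_hull B"
  using assms comb_subset[OF assms(2)] sum_subset_if[OF assms(2)]
  unfolding long_affine_hull_def by metis

lemma long_affine_hullD:
  assumes "long_affine_hull A" "sum l A \<noteq> 0"
  shows "comb l A \<bullet> comb l A > (sum l A)\<^sup>2"
proof -
  let ?m = "\<lambda>e. inverse (sum l A) * l e"
  have "sum ?m A = 1" using assms(2) by (simp flip: sum_distrib_left)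
  then have "comb ?m A \<bullet> comb ?m A > 1" using assms(1) unfolding long_affine_hull_def by blast
  then show ?thesis using assms(2) unfolding comb_scale
    by (simp add: divide_simps power2_eq_square flip: mult.assoc)
      (simp add: field_simps zero_less_mult_iff split: if_splits)
qed

lemma splits_cross:
  fixes F :: "'v::finite set set"
  assumes "linear_hypergraph F" "splits F (graph_complement F (line_graph F)) X Y"
  shows "cross_intersecting X Y"
  unfolding cross_intersecting_def
proof (intro ballI)
  fix e f assume "e \<in> X" "f \<in> Y"
  then have "e \<in> F" "f \<in> F" "e \<noteq> f" "e \<inter> f \<noteq> {}"
    using assms(2) by (auto simp: splits_def graph_complement_def line_graph_def)
  moreover then have "card (e \<inter> f) \<le> 1" using assms(1) by (auto simp: linear_hypergraph_def)
  ultimately show "card (e \<inter> f) = 1" using finite[of "e \<inter> f"] by (metis One_nat_def card_gt_0_iff le_antisym Suc_leI)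
qed

section \<open>Families with affine hull far from the origin\<close>

lemma uniform_hypergraph_subset: "uniform_hypergraph s F \<Longrightarrow> C \<subseteq> F \<Longrightarrow> uniform_hypergraph s C"
  by (auto simp: uniform_hypergraph_def)

lemma linear_hypergraph_subset: "linear_hypergraph F \<Longrightarrow> C \<subseteq> F \<Longrightarrow> linear_hypergraph C"
  by (auto simp: linear_hypergraph_def)

lemma disjoint_inner:
  assumes "\<And>e. e \<in> A \<Longrightarrow> e \<inter> f = {}"
  shows "comb l A \<bullet> incidence_vec f = 0"
  using assms by (simp add: comb_inner inner_incidence_vec)

lemma splits_line_graph_disjoint:
  assumes "splits F (line_graph F) X Y" "e \<in> X" "f \<in> Y"
  shows "e \<inter> f = {}"
  using assms by (auto simp: splits_def line_graph_def)

lemma uniform_inner_self: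
  "uniform_hypergraph s F \<Longrightarrow> e \<in> F \<Longrightarrow> incidence_vec e \<bullet> incidence_vec e = real s"
  by (simp add: uniform_hypergraph_def inner_incidence_vec)

lemma independent_edges_Un:
  assumes X: "independent_edges X" and Y: "independent_edges Y" and dj: "X \<inter> Y = {}"
    and "\<And>l. comb l X + comb l Y = 0 \<Longrightarrow> comb l X = 0"
  shows "independent_edges (X \<union> Y)"
  unfolding independent_edges_def
proof (intro allI impI)
  fix l assume "comb l (X \<union> Y) = 0"
  then have z: "comb l X + comb l Y = 0" by (simp add: comb_Un[OF dj])
  then have "comb l X = 0" by (rule assms(4))
  with z have "comb l X = 0" "comb l Y = 0" by simp_all
  then show "\<forall>e\<in>X \<union> Y. l e = 0" using X Y unfolding independent_edges_def by blast
qed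

lemma comb_glue:
  assumes "X \<inter> Y = {}"
  shows "comb (\<lambda>e. if e \<in> X then l e else m e) (X \<union> Y) = comb l X + comb m Y"
proof -
  have "comb (\<lambda>e. if e \<in> X then l e else m e) X = comb l X" by (rule comb_cong) simp
  moreover have "comb (\<lambda>e. if e \<in> X then l e else m e) Y = comb m Y"
    using assms by (intro comb_cong) auto
  ultimately show ?thesis by (simp add: comb_Un[OF assms])
qed

text \<open>
  The weights \<open>a\<close> solve \<open>M a = 1\<close> for the Gram matrix \<open>M\<close> of the edges: up to scaling they
  are the coefficients of the shortest vector of the affine hull.
\<close>

definition nonneg_dual :: "('v set \<Rightarrow> real) \<Rightarrow> 'v::finite set set \<Rightarrow> bool" where
  "nonneg_dual a F \<longleftrightarrow> (\<forall>e\<in>F. a e \<ge> 0 \<and> comb a F \<bullet> incidence_vec e = 1)"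

lemma nonneg_dual_self:
  assumes "nonneg_dual a F" shows "comb a F \<bullet> comb a F = sum a F"
  using comb_inner_const[of F "comb a F" 1 a] assms by (simp add: nonneg_dual_def)

text \<open>The Gram matrix is block diagonal, so the two solutions are simply put together.\<close>

lemma nonneg_dual_disjoint_Un:
  assumes X: "nonneg_dual a X" and Y: "nonneg_dual b Y" and "X \<inter> Y = {}"
    and dj: "\<And>e f. e \<in> X \<Longrightarrow> f \<in> Y \<Longrightarrow> e \<inter> f = {}"
  shows "nonneg_dual (\<lambda>e. if e \<in> X then a e else b e) (X \<union> Y)"
  unfolding nonneg_dual_def
proof (intro ballI)
  fix e assume "e \<in> X \<union> Y"
  then consider "e \<in> X" | "e \<in> Y" "e \<notin> X" by blast
  then show "0 \<le> (if e \<in> X then a e else b e) \<and>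
      comb (\<lambda>e. if e \<in> X then a e else b e) (X \<union> Y) \<bullet> incidence_vec e = 1"
  proof cases
    case 1
    then have "comb b Y \<bullet> incidence_vec e = 0" using dj by (intro disjoint_inner) blast
    then show ?thesis using 1 X by (simp add: comb_glue[OF assms(3)] inner_add_left nonneg_dual_def)
  next
    case 2
    then have "comb a X \<bullet> incidence_vec e = 0" using dj by (intro disjoint_inner) blast
    then show ?thesis using 2 Y by (simp add: comb_glue[OF assms(3)] inner_add_left nonneg_dual_def)
  qed
qed

lemma cross_intersecting_sym:
  assumes "cross_intersecting X Y" shows "cross_intersecting Y X"
  unfolding cross_intersecting_def
proof (intro ballI)
  fix e f assume "e \<in> Y" "f \<in> X"
  then have "card (f \<inter> e) = 1" using assms by (simp add: cross_intersecting_def)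
  then show "card (e \<inter> f) = 1" by (simp add: Int_commute)
qed

text \<open>The off-diagonal Gram blocks consist of ones, so each part sees the other only through
  its total weight. Rescaling the two solutions then suffices.\<close>

lemma nonneg_dual_cross_Un:
  assumes X: "nonneg_dual a X" and Y: "nonneg_dual b Y" and "X \<inter> Y = {}"
    and cr: "cross_intersecting X Y" and lt: "sum a X < 1" "sum b Y < 1"
  shows "\<exists>c. nonneg_dual c (X \<union> Y)"
proof -
  define p q where "p = sum a X" and "q = sum b Y"
  have p: "0 \<le> p" "p < 1" and q: "0 \<le> q" "q < 1"
    using assms by (auto simp: p_def q_def nonneg_dual_def intro: sum_nonneg)
  have "p * q \<le> 1 * q" using p q by (intro mult_right_mono) auto
  then have pq: "p * q < 1" using q by simp
  \<comment> \<open>The solution of \<open>g + h * q = 1\<close>, \<open>h + g * p = 1\<close>; it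
    is nonnegative because \<open>p\<close> and \<open>q\<close> are below 1.\<close>
  define g h where "g = (1 - q) / (1 - p * q)" and "h = (1 - p) / (1 - p * q)"
  have gh: "g \<ge> 0" "h \<ge> 0" "g + h * q = 1" "h + g * p = 1"
    using p q pq by (auto simp: g_def h_def field_simps)
  let ?c = "\<lambda>e. if e \<in> X then g * a e else h * b e"
  have c: "comb ?c (X \<union> Y) = g *\<^sub>R comb a X + h *\<^sub>R comb b Y"
    using comb_glue[OF assms(3)] by (simp add: comb_scale)
  have "nonneg_dual ?c (X \<union> Y)"
    unfolding nonneg_dual_def
  proof (intro ballI)
    fix e assume "e \<in> X \<union> Y"
    then consider "e \<in> X" | "e \<in> Y" "e \<notin> X" by blast
    then show "0 \<le> ?c e \<and> comb ?c (X \<union> Y) \<bullet> incidence_vec e = 1"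
    proof cases
      case 1
      have "comb b Y \<bullet> incidence_vec e = q"
        using cross_inner[OF cross_intersecting_sym[OF cr] 1] by (simp add: q_def)
      moreover have "comb a X \<bullet> incidence_vec e = 1" "a e \<ge> 0" using X 1 by (auto simp: nonneg_dual_def)
      ultimately show ?thesis using gh 1 unfolding c by (simp add: inner_add_left)
    next
      case 2
      have "comb a X \<bullet> incidence_vec e = p"
        using cross_inner[OF cr 2(1)] by (simp add: p_def)
      moreover have "comb b Y \<bullet> incidence_vec e = 1" "b e \<ge> 0" using Y 2 by (auto simp: nonneg_dual_def)
      ultimately show ?thesis using gh 2 unfolding c by (simp add: inner_add_left)
    qed
  qed
  then show ?thesis by blast
qed

text \<open>The squared norm of the dual combination is its own weight \<open>t\<close>, so length
  forces \<open>t^2 < t\<close> unless \<open>t = 0\<close>.\<close>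

lemma long_nonneg_dual_sum_less_1:
  assumes "long_affine_hull F" "nonneg_dual a F"
  shows "sum a F < 1"
proof (cases "sum a F = 0")
  case False
  then have "(sum a F)\<^sup>2 < sum a F"
    using long_affine_hullD[OF assms(1), of a] nonneg_dual_self[OF assms(2)] by simp
  moreover have "sum a F \<ge> 0" using assms(2) by (auto simp: nonneg_dual_def intro: sum_nonneg)
  ultimately show ?thesis by (simp add: power2_eq_square mult_less_cancel_left2)
qed simp

text \<open>Subfamilies inherit the hypotheses, so the cograph split allows induction. In a disjoint
  union the two spans are orthogonal; in a join, a dependency would need a part whose norm equals
  the absolute value of its weight, which length permits only for the zero vector.\<close>

lemma long_affine_hull_structure:
  fixes F :: "'v::finite set set"
  assumes "s > 0" "uniform_hypergraph s F" "linear_hypergraph F" "cograph F (line_graph F)"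
    and "long_affine_hull F"
  shows "independent_edges F \<and> (\<exists>a. nonneg_dual a F)"
  using finite[of F] assms(2-)
proof (induction F rule: finite_psubset_induct)
  case (psubset F)
  consider "card F = 0" | "card F = 1" | "card F \<ge> 2" by linarith
  then consider "F = {}" | e where "F = {e}" | "card F \<ge> 2"
    by (metis card_1_singletonE card_eq_0_iff finite)
  then show ?case
  proof cases
    case 1
    then show ?thesis by (simp add: independent_edges_def nonneg_dual_def)
  next
    case (2 e)
    have e: "incidence_vec e \<bullet> incidence_vec e = real s"
      using 2 psubset.prems uniform_inner_self by blast
    then have "incidence_vec e \<noteq> 0" using \<open>s > 0\<close> by force
    then have "independent_edges F" by (simp add: 2 independent_edges_def comb_def)
    moreover have "nonneg_dual (\<lambda>_. 1 / real s) F" using e \<open>s > 0\<close> by (simp add: 2 nonneg_dual_def comb_def)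
    ultimately show ?thesis by blast
  next
    case 3
    obtain X Y where XY: "splits F (line_graph F) X Y \<or> splits F (graph_complement F (line_graph F)) X Y"
      using cograph_split[OF finite 3 sym_line_graph psubset.prems(3)] by blast
    then have F: "F = X \<union> Y" and dj: "X \<inter> Y = {}" and "X \<noteq> {}" "Y \<noteq> {}"
      by (auto simp: splits_def)
    then have sub: "X \<subset> F" "Y \<subset> F" "X \<noteq> Y" by auto
    have lng: "long_affine_hull C" if "C \<subset> F" for C
      using that long_affine_hull_subset[OF psubset.prems(4)] by blast
    have IH: "independent_edges C \<and> (\<exists>a. nonneg_dual a C)" if C: "C \<subset> F" for C
    proof -
      have "C \<subseteq> F" using C by blast
      note sub = uniform_hypergraph_subset[OF _ this] linear_hypergraph_subset[OF _ this]
        cograph_line_graph_subset[OF _ this] long_affine_hull_subset[OF _ this]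
      show ?thesis by (rule psubset.IH[OF C]) (rule sub, rule psubset.prems)+
    qed
    have ind: "independent_edges X" "independent_edges Y"
      using IH[OF sub(1)] IH[OF sub(2)] by simp_all
    obtain a where a: "nonneg_dual a X" using IH[OF sub(1)] by auto
    obtain b where b: "nonneg_dual b Y" using IH[OF sub(2)] by auto
    from XY show ?thesis
    proof
      assume sp: "splits F (line_graph F) X Y"
      then have disj: "\<And>e f. e \<in> X \<Longrightarrow> f \<in> Y \<Longrightarrow> e \<inter> f = {}"
        by (rule splits_line_graph_disjoint)
      have "independent_edges (X \<union> Y)"
      proof (rule independent_edges_Un[OF ind dj])
        fix l assume z: "comb l X + comb l Y = 0"
        have "comb l X \<bullet> comb l Y = 0 * sum l Y"
          using disj by (intro comb_inner_const disjoint_inner) auto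
        moreover have "comb l Y = - comb l X" using z by (simp add: eq_neg_iff_add_eq_0 add.commute)
        ultimately show "comb l X = 0" by simp
      qed
      moreover have "\<exists>c. nonneg_dual c (X \<union> Y)"
        using nonneg_dual_disjoint_Un[OF a b dj disj] by blast
      ultimately show ?thesis using F by simp
    next
      assume "splits F (graph_complement F (line_graph F)) X Y"
      then have cr: "cross_intersecting X Y" using splits_cross psubset.prems(2) by blast
      have "independent_edges (X \<union> Y)"
      proof (rule independent_edges_Un[OF ind dj])
        fix l assume z: "comb l X + comb l Y = 0"
        have "uniform_hypergraph s X" "uniform_hypergraph s Y"
          using sub uniform_hypergraph_subset[OF psubset.prems(1)] by blast+
        then have "comb l X \<bullet> comb l X = (sum l X)\<^sup>2"
          using z sub(3) cr cross_intersecting_sym[OF cr]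
          by (intro join_dependency(3)[OF \<open>s > 0\<close>, of "{X, Y}" "\<lambda>_. l" X]) auto
        \<comment> \<open>A nonzero weight contradicts length, and weight 0 makes the squared norm
          0.\<close>
        then show "comb l X = 0" using long_affine_hullD[OF lng[OF sub(1)], of l] by force
      qed
      moreover have "\<exists>c. nonneg_dual c (X \<union> Y)"
        using lng sub a b by (intro nonneg_dual_cross_Un[OF a b dj cr] long_nonneg_dual_sum_less_1)
      ultimately show ?thesis using F by simp
    qed
  qed
qed

section \<open>Centers and balanced co-components\<close>

lemma card_Union_partition:
  fixes P :: "'v::finite set set set"
  assumes "\<And>C D. C \<in> P \<Longrightarrow> D \<in> P \<Longrightarrow> C \<noteq> D \<Longrightarrow> C \<inter> D = {}"
  shows "card (\<Union>P) = (\<Sum>C\<in>P. card C)"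
  by (rule card_Union_disjoint) (auto simp: pairwise_def disjnt_def assms)

locale linear_cograph =
  fixes s :: nat and F :: "'v::finite set set"
  assumes s: "s \<ge> 2" and uniform: "uniform_hypergraph s F" and linear: "linear_hypergraph F"
    and cograph: "cograph F (line_graph F)"
begin

lemma s_pos: "s > 0" using s by simp

text \<open>Edges of different components are disjoint, so the components span mutually orthogonal
  subspaces and both ranks and cardinalities add up.\<close>

lemma R_line_components: "R s F = (\<Sum>C\<in>line_components F. R s C)"
proof -
  let ?P = "line_components F"
  have F: "F = \<Union>?P" using line_components_partition(1) by blast
  have dj: "e \<inter> f = {}" if "C \<in> ?P" "D \<in> ?P" "C \<noteq> D" "e \<in> C" "f \<in> D" for C D e f
    using line_components_partition(4)[OF that] line_components_partition(3)[OF that(1-3)] that F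
    by (auto simp: line_graph_def)
  have "dim (\<Union>C\<in>?P. incidence_vec ` C) = (\<Sum>C\<in>?P. dim (incidence_vec ` C))"
  proof (rule dim_UN_independent; (intro ballI)?)
    fix u C assume u: "\<And>C. C \<in> ?P \<Longrightarrow> u C \<in> span (incidence_vec ` C)" and z: "sum u ?P = 0"
      and C: "C \<in> ?P"
    have "u D \<bullet> u C = 0" if D: "D \<in> ?P" "D \<noteq> C" for D
    proof -
      obtain l m where "u D = comb l D" "u C = comb m C"
        using u[OF C] u[OF D(1)] unfolding span_incidence by blast
      moreover have "comb l D \<bullet> comb m C = 0 * sum m C"
        using dj D C by (intro comb_inner_const disjoint_inner) blast
      ultimately show ?thesis by simp
    qed
    then have "sum u ?P \<bullet> u C = u C \<bullet> u C"
      using sum.remove[OF _ C, of "\<lambda>D. u D \<bullet> u C"] by (simp add: inner_sum_left)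
    then show "u C = 0" using z by simp
  qed simp
  then have dim: "dim (incidence_vec ` F) = (\<Sum>C\<in>?P. dim (incidence_vec ` C))"
    by (subst F) (simp add: image_Union image_image)
  have "card F = (\<Sum>C\<in>?P. card C)"
    using card_Union_partition[of ?P] line_components_partition(3) F by metis
  with dim show ?thesis
    by (simp add: R_def rank_incidence_matrix sum_subtractf sum_distrib_left)
qed

section \<open>Centers of co-components\<close>

lemma cocomponent_subset: "C \<in> cocomponents F \<Longrightarrow> C \<subseteq> F"
  using cocomponents_partition(1) by blast

lemma cross:
  assumes "C \<in> cocomponents F" "D \<in> cocomponents F" "C \<noteq> D"
  shows "cross_intersecting C D"
  unfolding cross_intersecting_def
proof (intro ballI)
  fix e f assume ef: "e \<in> C" "f \<in> D"
  have "e \<in> F" "f \<in> F" "e \<noteq> f"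
    using ef assms cocomponent_subset cocomponents_partition(3)[OF assms] by auto
  moreover from this have "e \<inter> f \<noteq> {}"
    using cocomponents_partition(4)[OF assms ef] by (auto simp: graph_complement_def line_graph_def)
  moreover have "card (e \<inter> f) \<le> 1" using linear calculation by (auto simp: linear_hypergraph_def)
  ultimately show "card (e \<inter> f) = 1"
    using finite[of "e \<inter> f"] by (metis One_nat_def card_gt_0_iff le_antisym Suc_leI)
qed

lemma uniform_cocomponent: "C \<in> cocomponents F \<Longrightarrow> uniform_hypergraph s C"
  using uniform cocomponent_subset uniform_hypergraph_subset by blast

text \<open>Such a combination is orthogonal to every \<open>diff_space D\<close>: for
  \<open>D = C\<close> by constancy, and otherwise because it has inner product 1 with each edge of
  \<open>D\<close>. It differs from an edge of \<open>C\<close> by an element of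
  \<open>diff_space C\<close>, so it is the projection.\<close>

lemma center_unique:
  assumes C: "C \<in> cocomponents F" and l: "sum l C = 1"
    and const: "\<And>e. e \<in> C \<Longrightarrow> comb l C \<bullet> incidence_vec e = k"
  shows "center F C = comb l C"
proof -
  let ?W = "total_diff_space F"
  obtain e where e: "e \<in> C" using cocomponents_partition(2)[OF C] by blast
  have orth: "comb l C \<bullet> x = 0" if D: "D \<in> cocomponents F" and x: "x \<in> diff_space D" for D x
  proof -
    have "\<exists>k. \<forall>e\<in>D. comb l C \<bullet> incidence_vec e = k"
    proof (cases "D = C")
      case False
      then show ?thesis using cross_inner[OF cross[OF C D]] by blast
    qed (use const in blast)
    then have "orthogonal (comb l C) y"
      if "y \<in> {incidence_vec e - incidence_vec f |e f. e \<in> D \<and> f \<in> D}" for y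
      using that by (auto simp: orthogonal_def inner_diff_right)
    then have "orthogonal (comb l C) x"
      using x unfolding diff_space_def by (rule orthogonal_to_span[rotated])
    then show ?thesis by (simp add: orthogonal_def)
  qed
  have "comb l C \<in> ?W\<^sup>\<bottom>"
    unfolding orthogonal_comp_def
  proof (clarify)
    fix w assume "w \<in> ?W"
    then obtain u where u: "\<forall>D\<in>cocomponents F. u D \<in> diff_space D" "w = sum u (cocomponents F)"
      unfolding total_diff_space_def by (subst (asm) set_sum_alt) auto
    then have "comb l C \<bullet> w = 0" using orth by (simp add: inner_sum_right)
    then show "orthogonal w (comb l C)" by (simp add: orthogonal_def inner_commute)
  qed
  moreover have "incidence_vec e - comb l C \<in> ?W\<^sup>\<bottom>\<^sup>\<bottom>"
  proof -
    have "incidence_vec e - comb l C = (\<Sum>f\<in>C. l f *\<^sub>R (incidence_vec e - incidence_vec f))"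
      using l by (simp add: comb_def scaleR_diff_right sum_subtractf flip: scaleR_sum_left)
    also have "\<dots> \<in> diff_space C"
      unfolding diff_space_def using e by (intro span_sum span_scale span_base) blast
    finally show ?thesis
      using diff_space_subset_total[OF C] orthogonal_comp_subset by blast
  qed
  ultimately have "orth_proj (?W\<^sup>\<bottom>) (incidence_vec e) = comb l C"
    by (intro orth_proj_eqI subspace_orthogonal_comp)
  then show ?thesis by (simp add: center_eq[OF C e])
qed

lemma diff_space_comb:
  assumes "x \<in> diff_space C"
  shows "\<exists>l. x = comb l C \<and> sum l C = 0"
  using assms unfolding diff_space_def
proof (induction rule: span_induct_alt)
  case base
  show ?case by (rule exI[of _ "\<lambda>_. 0"]) (simp add: comb_def)
next
  case (step k x y)
  then obtain e f l where "e \<in> C" "f \<in> C" and x: "x = incidence_vec e - incidence_vec f"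
    and l: "y = comb l C" "sum l C = 0" by blast
  let ?d = "\<lambda>e g. if g = e then 1 else (0::real)"
  have "k *\<^sub>R x + y = comb (\<lambda>g. k * (?d e g - ?d f g) + l g) C"
    using \<open>e \<in> C\<close> \<open>f \<in> C\<close> by (simp only: comb_add comb_scale comb_diff comb_single x l)
  moreover have "sum (\<lambda>g. k * (?d e g - ?d f g) + l g) C = 0"
    using \<open>e \<in> C\<close> \<open>f \<in> C\<close> l by (simp add: sum.distrib sum_subtractf flip: sum_distrib_left)
  ultimately show ?case by blast
qed

text \<open>Removing from an edge its projection onto \<open>diff_space C\<close> alone already
  leaves a vector with constant inner products on \<open>C\<close>, so the other co-components do
  not affect the center.\<close>

lemma center_comb:
  assumes C: "C \<in> cocomponents F"
  obtains l where "sum l C = 1" "center F C = comb l C"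
    "\<And>e. e \<in> C \<Longrightarrow> center F C \<bullet> incidence_vec e = center F C \<bullet> center F C"
proof -
  obtain e where e: "e \<in> C" using cocomponents_partition(2)[OF C] by blast
  have W: "subspace (diff_space C)" by (simp add: diff_space_def)
  define d where "d = orth_proj (diff_space C) (incidence_vec e)"
  have d: "d \<in> diff_space C" "incidence_vec e - d \<in> (diff_space C)\<^sup>\<bottom>"
    unfolding d_def using orth_proj[OF W] by blast+
  obtain m where m: "d = comb m C" "sum m C = 0" using diff_space_comb[OF d(1)] by blast
  \<comment> \<open>Weight 1 at \<open>e\<close>, minus the weights of \<open>d\<close>, which total
    0.\<close>
  let ?l = "\<lambda>f. (if f = e then 1 else 0) - m f"
  have l: "comb ?l C = incidence_vec e - d" "sum ?l C = 1"
    using e m by (simp_all add: comb_diff comb_single sum_subtractf)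
  have const: "comb ?l C \<bullet> incidence_vec f = comb ?l C \<bullet> incidence_vec e" if f: "f \<in> C" for f
  proof -
    have "incidence_vec f - incidence_vec e \<in> diff_space C"
      unfolding diff_space_def using e f by (intro span_base) blast
    then have "(incidence_vec f - incidence_vec e) \<bullet> (incidence_vec e - d) = 0"
      using d(2) by (auto simp: orthogonal_comp_def orthogonal_def)
    then show ?thesis unfolding l(1) by (simp add: inner_diff_right inner_diff_left inner_commute)
  qed
  have c: "center F C = comb ?l C" by (rule center_unique[OF C l(2) const])
  have "comb ?l C \<bullet> comb ?l C = comb ?l C \<bullet> incidence_vec e"
    using comb_inner_const[OF const] l(2) by simp
  then show ?thesis using const by (intro that[OF l(2) c]) (simp only: c)
qed

text \<open>A connected line graph has no split, so its complement has one, and no co-component,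
  being connected in the complement, can meet both sides.\<close>

lemma card_cocomponents_ge_2:
  assumes conn: "graph_connected F (line_graph F)" and "card F \<ge> 2"
  shows "card (cocomponents F) \<ge> 2"
proof -
  have "line_graph F \<inter> F \<times> F = line_graph F" using line_graph_Times by blast
  then have "\<not> splits F (line_graph F) X Y" for X Y using splits_not_connected conn by metis
  then obtain X Y where "splits F (graph_complement F (line_graph F)) X Y"
    using cograph_split[OF finite assms(2) sym_line_graph cograph] by blast
  then obtain e f where ef: "e \<in> X" "f \<in> Y" and XY: "X \<union> Y = F" "X \<inter> Y = {}"
    and no: "\<And>x y. x \<in> X \<Longrightarrow> y \<in> Y \<Longrightarrow> (x, y) \<notin> graph_complement F (line_graph F)"
    by (auto simp: splits_def)
  obtain C D where C: "C \<in> cocomponents F" "e \<in> C" and D: "D \<in> cocomponents F" "f \<in> D"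
    using cocomponents_partition(1) ef XY by (metis UnI1 UnI2 UnionE)
  have "C \<noteq> D"
  proof
    assume "C = D"
    have "C = (C \<inter> X) \<union> (C \<inter> Y)" using XY cocomponent_subset[OF C(1)] by blast
    then have "splits C (graph_complement F (line_graph F)) (C \<inter> X) (C \<inter> Y)"
      using no C D ef XY \<open>C = D\<close> unfolding splits_def by blast
    then show False using splits_not_connected cocomponents_partition(5)[OF C(1)] by blast
  qed
  then have "card {C, D} = 2" by simp
  then show ?thesis using card_mono[of "cocomponents F" "{C, D}"] C D by simp
qed

lemma balanced_iff: "balanced F C \<longleftrightarrow> center F C \<bullet> center F C = 1"
  by (simp add: balanced_def power2_norm_eq_inner)

section \<open>Structure of balanced co-components\<close>

lemma balanced_inner:
  assumes "C \<in> balanced_cocomponents F" "e \<in> C"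
  shows "center F C \<bullet> incidence_vec e = 1"
proof -
  have C: "C \<in> cocomponents F" and bal: "center F C \<bullet> center F C = 1"
    using assms(1) by (auto simp: balanced_cocomponents_def balanced_iff)
  from center_comb[OF C] show ?thesis using assms(2) bal by metis
qed

text \<open>A single edge is its own center, of squared norm \<open>s\<close>, hence not balanced.
  With two or more edges a split exists, and connectedness in the complement leaves only a split of
  the line graph.\<close>

lemma balanced_splits:
  assumes B: "C \<in> balanced_cocomponents F"
  shows "\<exists>X Y. splits C (line_graph C) X Y"
proof -
  have C: "C \<in> cocomponents F" and bal: "center F C \<bullet> center F C = 1"
    using B by (auto simp: balanced_cocomponents_def balanced_iff)
  have "card C \<noteq> 0" using cocomponents_partition(2)[OF C] by simp
  moreover have "card C \<noteq> 1"
  proof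
    assume "card C = 1"
    then obtain e where Ce: "C = {e}" by (auto simp: card_1_singleton_iff)
    have se: "incidence_vec e \<bullet> incidence_vec e = real s"
      using uniform_inner_self[OF uniform_cocomponent[OF C]] Ce by blast
    have "center F C = comb (\<lambda>_. 1) C"
      by (rule center_unique[OF C, of _ "real s"]) (use se in \<open>simp_all add: Ce comb_def\<close>)
    then show False using bal se s by (simp add: Ce comb_def)
  qed
  ultimately have "card C \<ge> 2" by linarith
  from cograph_split[OF finite this sym_line_graph
      cograph_line_graph_subset[OF cograph cocomponent_subset[OF C]]]
  obtain X Y where "splits C (line_graph C) X Y \<or>
      splits C (graph_complement C (line_graph C)) X Y"
    by blast
  moreover have "\<not> splits C (graph_complement C (line_graph C)) X Y"
  proof
    assume "splits C (graph_complement C (line_graph C)) X Y"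
    then have "splits C (graph_complement F (line_graph F)) X Y"
      using cocomponent_subset[OF C]
      by (auto simp: splits_def complement_line_graph_subset)
    then show False using splits_not_connected cocomponents_partition(5)[OF C] by blast
  qed
  ultimately show ?thesis by blast
qed

text \<open>The center is the shortest point of the affine hull of \<open>C\<close>, so no point
  there has norm below 1. A point of the hull of \<open>X\<close> with norm at most 1 could be
  shortened below 1 by mixing in the orthogonal vector of \<open>e\<close>.\<close>

lemma balanced_part_long:
  assumes B: "C \<in> balanced_cocomponents F" and "X \<subseteq> C" "e \<in> C"
    and dj: "\<And>f. f \<in> X \<Longrightarrow> f \<inter> e = {}"
  shows "long_affine_hull X"
  unfolding long_affine_hull_def
proof (intro allI impI)
  fix l :: "'v set \<Rightarrow> real" assume l: "sum l X = 1"
  let ?c = "center F C" and ?u = "comb l X" and ?x = "incidence_vec e"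
  have C: "C \<in> cocomponents F" and bal: "?c \<bullet> ?c = 1"
    using B by (auto simp: balanced_cocomponents_def balanced_iff)
  have cu: "?c \<bullet> ?u = 1"
    using comb_inner_const[of X ?c 1 l] balanced_inner[OF B] assms(2) l by auto
  have cx: "?c \<bullet> ?x = 1" using balanced_inner[OF B] assms(3) .
  have ux: "?u \<bullet> ?x = 0" using dj by (rule disjoint_inner)
  have xx: "?x \<bullet> ?x = real s" using uniform_inner_self[OF uniform_cocomponent[OF C]] assms(3) .
  \<comment> \<open>This value minimises \<open>(1 - d)^2 + d^2 * s\<close>; the minimum is
    \<open>1 - d\<close>.\<close>
  define d where "d = 1 / (real s + 1)"
  have d: "d > 0" "d * (real s + 1) = 1" "d \<le> 1" by (auto simp: d_def)
  define y where "y = (1 - d) *\<^sub>R ?u + d *\<^sub>R ?x"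
  have cy: "?c \<bullet> y = 1" by (simp add: y_def inner_add_right cu cx)
  have "0 \<le> (y - ?c) \<bullet> (y - ?c)" by simp
  then have "1 \<le> y \<bullet> y" using cy bal by (simp add: inner_diff_left inner_diff_right inner_commute)
  also have "y \<bullet> y = (1 - d)\<^sup>2 * (?u \<bullet> ?u) + d\<^sup>2 * s"
    using ux xx unfolding y_def
    by (simp add: inner_add_left inner_add_right inner_commute[of ?x ?u] power2_eq_square)
  finally have ge: "1 \<le> (1 - d)\<^sup>2 * (?u \<bullet> ?u) + d\<^sup>2 * s" .
  show "?u \<bullet> ?u > 1"
  proof (rule ccontr)
    assume "\<not> ?thesis"
    then have "(1 - d)\<^sup>2 * (?u \<bullet> ?u) \<le> (1 - d)\<^sup>2 * 1" by (intro mult_left_mono) auto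
    moreover have "(1 - d)\<^sup>2 + d\<^sup>2 * s = 1 - 2 * d + d * (d * (real s + 1))"
      by (simp add: power2_eq_square algebra_simps)
    ultimately show False using ge d by simp
  qed
qed

text \<open>Each side of the split is disjoint from an edge of the other, so both have long affine
  hulls and hence independence and dual weights, which pass to the disjoint union
  \<open>C\<close>.\<close>

lemma balanced_weights:
  assumes B: "C \<in> balanced_cocomponents F"
  obtains a where "independent_edges C" "nonneg_dual a C" "center F C = comb a C" "sum a C = 1"
proof -
  have C: "C \<in> cocomponents F" and bal: "center F C \<bullet> center F C = 1"
    using B by (auto simp: balanced_cocomponents_def balanced_iff)
  obtain X Y where sp: "splits C (line_graph C) X Y" using balanced_splits[OF B] by blast
  then have XY: "C = X \<union> Y" "X \<inter> Y = {}" "X \<noteq> {}" "Y \<noteq> {}" by (auto simp: splits_def)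
  have disj: "e \<inter> f = {}" if "e \<in> X" "f \<in> Y" for e f
    using splits_line_graph_disjoint[OF sp that] .
  obtain x y where xy: "x \<in> X" "y \<in> Y" using XY by blast
  have X: "long_affine_hull X"
    by (rule balanced_part_long[OF B, of X y]) (use XY xy disj in auto)
  have Y: "long_affine_hull Y"
    by (rule balanced_part_long[OF B, of Y x]) (use XY xy disj in auto)
  have "independent_edges D \<and> (\<exists>a. nonneg_dual a D)" if "D = X \<or> D = Y" for D
  proof -
    have "D \<subseteq> F" using that XY cocomponent_subset[OF C] by auto
    then show ?thesis
      using that X Y
      by (intro long_affine_hull_structure[OF s_pos] uniform_hypergraph_subset[OF uniform]
          linear_hypergraph_subset[OF linear] cograph_line_graph_subset[OF cograph]) auto
  qed
  from this[of X] this[of Y] obtain a b where ind: "independent_edges X" "independent_edges Y"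
    and ab: "nonneg_dual a X" "nonneg_dual b Y" by auto
  have "independent_edges (X \<union> Y)"
  proof (rule independent_edges_Un[OF ind XY(2)])
    fix l assume z: "comb l X + comb l Y = 0"
    have "comb l X \<bullet> comb l Y = 0 * sum l Y"
      using disj by (intro comb_inner_const disjoint_inner) auto
    moreover have "comb l Y = - comb l X" using z by (simp add: eq_neg_iff_add_eq_0 add.commute)
    ultimately show "comb l X = 0" by simp
  qed
  then have i: "independent_edges C" by (simp add: XY)
  obtain c where c: "nonneg_dual c C"
    using nonneg_dual_disjoint_Un[OF ab XY(2) disj] unfolding XY(1) by blast
  obtain m where m: "center F C = comb m C" using center_comb[OF C] by blast
  \<comment> \<open>The difference of the center and the dual combination lies in the span of
    \<open>C\<close> and is orthogonal to all edges of \<open>C\<close>, so it vanishes.\<close>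
  define l where "l = (\<lambda>e. m e - c e)"
  have l: "center F C - comb c C = comb l C" by (simp add: l_def comb_diff m)
  have "comb l C \<bullet> incidence_vec e = 0" if "e \<in> C" for e
    using balanced_inner[OF B that] c that unfolding l[symmetric]
    by (simp add: inner_diff_left nonneg_dual_def)
  then have "comb l C \<bullet> comb l C = 0 * sum l C" by (rule comb_inner_const)
  then have cc: "center F C = comb c C" using l by simp
  moreover have "sum c C = 1" using nonneg_dual_self[OF c] bal cc by simp
  ultimately show ?thesis using that i c by blast
qed

subsection \<open>Ranks and the count of balanced co-components\<close>

lemma balanced_cocomponent: "C \<in> balanced_cocomponents F \<Longrightarrow> C \<in> cocomponents F"
  by (simp add: balanced_cocomponents_def)

text \<open>All terms of the Gram equation of \<open>e\<close> are nonnegative, and the diagonal one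
  is \<open>s * a e\<close>.\<close>

lemma balanced_weight_le:
  assumes "C \<in> balanced_cocomponents F" "nonneg_dual a C" "e \<in> C"
  shows "a e \<le> 1 / s"
proof -
  have C: "uniform_hypergraph s C"
    using balanced_cocomponent[OF assms(1)] uniform_cocomponent by blast
  have "a e * (incidence_vec e \<bullet> incidence_vec e) \<le> (\<Sum>f\<in>C. a f * (incidence_vec f \<bullet> incidence_vec e))"
    using assms by (intro member_le_sum) (auto simp: nonneg_dual_def inner_incidence_vec)
  also have "\<dots> = 1" using assms by (simp add: nonneg_dual_def flip: comb_inner)
  finally show ?thesis using s_pos by (simp add: uniform_inner_self[OF C assms(3)] field_simps)
qed

lemma balanced_card_ge:
  assumes B: "C \<in> balanced_cocomponents F"
  shows "s \<le> card C"
proof -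
  obtain a where a: "nonneg_dual a C" "sum a C = 1" using balanced_weights[OF B] by metis
  have "sum a C \<le> (\<Sum>e\<in>C. 1 / s)" using balanced_weight_le[OF B a(1)] by (intro sum_mono)
  then show ?thesis using a(2) s_pos by (simp add: field_simps)
qed

text \<open>Now \<open>s\<close> weights of at most \<open>1 / s\<close> add up to 1, so all are
  equal. The Gram equation of \<open>e\<close> then makes the inner products with \<open>e\<close>
  total \<open>s\<close>, which \<open>e\<close> itself exhausts.\<close>

lemma balanced_card_eq:
  assumes B: "C \<in> balanced_cocomponents F" and "card C = s"
  shows "center F C = (1 / s) *\<^sub>R comb (\<lambda>_. 1) C"
    and "e \<in> C \<Longrightarrow> f \<in> C \<Longrightarrow> e \<noteq> f \<Longrightarrow> e \<inter> f = {}"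
proof -
  obtain a where a: "nonneg_dual a C" "sum a C = 1" "center F C = comb a C"
    using balanced_weights[OF B] by metis
  have C: "uniform_hypergraph s C"
    using balanced_cocomponent[OF B] uniform_cocomponent by blast
  have "(\<Sum>e\<in>C. 1 / s - a e) = 0"
    using a(2) assms(2) s_pos by (simp add: sum_subtractf)
  then have "\<forall>e\<in>C. 1 / s - a e = 0"
    using balanced_weight_le[OF B a(1)] by (subst (asm) sum_nonneg_eq_0_iff) auto
  then have ae: "a e = 1 / s" if "e \<in> C" for e using that by simp
  then have "comb a C = comb (\<lambda>e. (1 / s) * 1) C" by (intro comb_cong) simp
  then show c: "center F C = (1 / s) *\<^sub>R comb (\<lambda>_. 1) C"
    unfolding a(3) comb_scale .
  show "e \<inter> f = {}" if ef: "e \<in> C" "f \<in> C" "e \<noteq> f" for e f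
  proof -
    have "(\<Sum>g\<in>C. incidence_vec g \<bullet> incidence_vec e) = s"
      using balanced_inner[OF B ef(1)] s_pos unfolding c by (simp add: comb_inner field_simps)
    moreover have "(\<Sum>g\<in>{e, f}. incidence_vec g \<bullet> incidence_vec e) \<le>
        (\<Sum>g\<in>C. incidence_vec g \<bullet> incidence_vec e)"
      using ef by (intro sum_mono2) (auto simp: inner_incidence_vec)
    ultimately have "incidence_vec f \<bullet> incidence_vec e \<le> 0"
      using ef uniform_inner_self[OF C ef(1)] by simp
    then have "card (f \<inter> e) = 0" by (simp add: inner_incidence_vec)
    then show ?thesis by (simp add: Int_commute)
  qed
qed

text \<open>Cross-intersection gives the two unit vectors inner product 1, so they coincide.\<close>

lemma center_balanced_eq:
  assumes B: "C \<in> balanced_cocomponents F" "D \<in> balanced_cocomponents F"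
  shows "center F C = center F D"
proof (cases "C = D")
  case False
  let ?c = "center F C" and ?d = "center F D"
  have CD: "C \<in> cocomponents F" "D \<in> cocomponents F" and n: "?c \<bullet> ?c = 1" "?d \<bullet> ?d = 1"
    using B by (auto simp: balanced_cocomponents_def balanced_iff)
  obtain l m where l: "sum l C = 1" "?c = comb l C" and m: "sum m D = 1" "?d = comb m D"
    using center_comb[OF CD(1)] center_comb[OF CD(2)] by metis
  have "?c \<bullet> incidence_vec f = 1" if "f \<in> D" for f
    using cross_inner[OF cross[OF CD False] that] l by simp
  then have "?c \<bullet> ?d = 1" using comb_inner_const[of D ?c 1 m] m by simp
  then have "(?c - ?d) \<bullet> (?c - ?d) = 0" using n by (simp add: inner_diff_left inner_diff_right inner_commute)
  then show ?thesis by simp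
qed simp

text \<open>
  These families cover the same vertices. Take an edge through a vertex \<open>v\<close> from each but one of
  them: these edges meet an edge of the last one avoiding \<open>v\<close> in distinct points.
\<close>

lemma card_balanced_small:
  "card {C \<in> balanced_cocomponents F. card C = s} \<le> s + 1"
proof -
  let ?A = "{C \<in> balanced_cocomponents F. card C = s}"
  show ?thesis
  proof (cases "?A = {}")
    case False
    then obtain C where C: "C \<in> balanced_cocomponents F" "card C = s" by blast
    then obtain g h where gh: "g \<in> C" "h \<in> C" "g \<noteq> h"
      using s by (metis card_le_Suc0_iff_eq finite not_less_eq_eq numeral_2_eq_2)
    have uni: "uniform_hypergraph s D" if "D \<in> ?A" for D
      using that balanced_cocomponent uniform_cocomponent by blast
    have "card g = s" "card h = s" using gh uni[of C] C by (auto simp: uniform_hypergraph_def)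
    then obtain v where v: "v \<in> h" using s by (metis all_not_in_conv card.empty not_numeral_le_zero)
    have vg: "v \<notin> g" using balanced_card_eq(2)[OF C gh] v by blast
    have comp: "comb (\<lambda>_. 1) D $ v = (\<Sum>e\<in>D. if v \<in> e then 1 else 0)" for D :: "'v set set"
      by (simp add: comb_def incidence_vec_def)
    \<comment> \<open>The common center is \<open>1 / s\<close> times the sum of the edges of either
      family, and its coordinate at \<open>v\<close> is positive because \<open>h\<close> belongs to
      \<open>C\<close>.\<close>
    have "\<exists>e\<in>D. v \<in> e" if D: "D \<in> ?A" for D
    proof (rule ccontr)
      assume "\<not> ?thesis"
      then have "comb (\<lambda>_. 1) D $ v = 0" unfolding comp by (intro sum.neutral) auto
      moreover have "(1 / s) *\<^sub>R comb (\<lambda>_. 1) D = (1 / s) *\<^sub>R comb (\<lambda>_. 1) C"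
      proof -
        have D': "D \<in> balanced_cocomponents F" "card D = s" using D by auto
        show ?thesis
          unfolding balanced_card_eq(1)[OF D', symmetric] balanced_card_eq(1)[OF C, symmetric]
          by (rule center_balanced_eq[OF D'(1) C(1)])
      qed
      ultimately have "comb (\<lambda>_. 1) C $ v = 0" using s_pos by simp
      then have "(\<Sum>e\<in>C. if v \<in> e then 1 else (0::real)) = 0" unfolding comp .
      then have "\<forall>e\<in>C. (if v \<in> e then 1 else (0::real)) = 0"
        by (subst (asm) sum_nonneg_eq_0_iff) auto
      then show False using gh(2) v by (auto split: if_splits)
    qed
    then obtain E where E: "\<And>D. D \<in> ?A \<Longrightarrow> E D \<in> D \<and> v \<in> E D" by metis
    have "\<exists>w. E D \<inter> g = {w}" if D: "D \<in> ?A - {C}" for D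
    proof -
      have "cross_intersecting D C" using D C balanced_cocomponent by (intro cross) auto
      then have "card (E D \<inter> g) = 1" using E[of D] D gh(1) by (auto simp: cross_intersecting_def)
      then show ?thesis by (simp add: card_1_singleton_iff)
    qed
    then obtain w where w: "\<And>D. D \<in> ?A - {C} \<Longrightarrow> E D \<inter> g = {w D}" by metis
    \<comment> \<open>Two of the chosen edges meet only in \<open>v\<close>, which is not in
      \<open>g\<close>.\<close>
    have "inj_on w (?A - {C})"
    proof (rule inj_onI, rule ccontr)
      fix D D' assume D: "D \<in> ?A - {C}" and D': "D' \<in> ?A - {C}" and eq: "w D = w D'" and ne: "D \<noteq> D'"
      have "cross_intersecting D D'" using D D' ne balanced_cocomponent by (intro cross) auto
      then have "card (E D \<inter> E D') = 1"
        using E[of D] E[of D'] D D' by (auto simp: cross_intersecting_def)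
      then obtain x where "E D \<inter> E D' = {x}" by (auto simp: card_1_singleton_iff)
      moreover have "v \<in> E D \<inter> E D'" using E[of D] E[of D'] D D' by blast
      moreover have "w D \<in> E D \<inter> E D'" "w D \<in> g" using w[OF D] w[OF D'] eq by blast+
      ultimately show False using vg by auto
    qed
    moreover have "w ` (?A - {C}) \<subseteq> g" using w by blast
    ultimately have "card (?A - {C}) \<le> card g" by (metis card_inj_on_le finite)
    moreover have "C \<in> ?A" using C by blast
    ultimately show ?thesis using \<open>card g = s\<close> by (simp add: card_Diff_singleton)
  next
    case True
    then show ?thesis by (simp only: card.empty)
  qed
qed

text \<open>Serves both rank formulas: \<open>G\<close> is the identity when at most one
  co-component is balanced, and otherwise drops an edge from each balanced one except
  \<open>C0\<close>. A part of nonzero weight in a dependency is a multiple of a balanced center,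
  which the second assumption excludes away from \<open>C0\<close>.\<close>

lemma dim_reduced:
  assumes G: "\<And>C. C \<in> cocomponents F \<Longrightarrow> G C \<subseteq> C"
    and c: "\<And>C. C \<in> balanced_cocomponents F \<Longrightarrow> C \<noteq> C0 \<Longrightarrow>
      center F C \<notin> span (incidence_vec ` G C)"
  shows "dim (\<Union>C\<in>cocomponents F. incidence_vec ` G C) =
    (\<Sum>C\<in>cocomponents F. dim (incidence_vec ` G C))"
proof (rule dim_UN_independent)
  let ?P = "cocomponents F"
  fix u assume u: "\<And>C. C \<in> ?P \<Longrightarrow> u C \<in> span (incidence_vec ` G C)" and z: "sum u ?P = 0"
  have "\<exists>l. u C = comb l C" if C: "C \<in> ?P" for C
  proof -
    have "u C \<in> span (incidence_vec ` C)" using u[OF C] span_mono[OF image_mono[OF G[OF C]]] by blast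
    then show ?thesis unfolding span_incidence by blast
  qed
  then obtain l where l: "\<And>C. C \<in> ?P \<Longrightarrow> u C = comb (l C) C" by metis
  then have z: "(\<Sum>C\<in>?P. comb (l C) C) = 0" using z by simp
  have dep: "(\<Sum>C\<in>?P. sum (l C) C) = 0"
    "\<And>C e. C \<in> ?P \<Longrightarrow> e \<in> C \<Longrightarrow> comb (l C) C \<bullet> incidence_vec e = sum (l C) C"
    "\<And>C. C \<in> ?P \<Longrightarrow> comb (l C) C \<bullet> comb (l C) C = (sum (l C) C)\<^sup>2"
    using join_dependency[OF s_pos _ _ z] uniform_cocomponent cross by simp_all
  have zero: "sum (l C) C = 0" if C: "C \<in> ?P" and ne: "C \<noteq> C0" for C
  proof (rule ccontr)
    assume nz: "sum (l C) C \<noteq> 0"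
    define k where "k = inverse (sum (l C) C)"
    have k: "k * sum (l C) C = 1" using nz by (simp add: k_def)
    have "center F C = comb (\<lambda>e. k * l C e) C"
      using k dep(2)[OF C]
      by (intro center_unique[OF C, of _ 1]) (simp_all add: comb_scale flip: sum_distrib_left)
    then have ctr: "center F C = k *\<^sub>R comb (l C) C" by (simp add: comb_scale)
    have "center F C \<bullet> center F C = (k * sum (l C) C)\<^sup>2"
      unfolding ctr using dep(3)[OF C] by (simp add: power2_eq_square)
    then have "C \<in> balanced_cocomponents F"
      using C k by (simp add: balanced_cocomponents_def balanced_iff)
    moreover have "center F C \<in> span (incidence_vec ` G C)"
      unfolding ctr using u[OF C] l[OF C] by (simp add: span_scale)
    ultimately show False using c ne by blast
  qed
  \<comment> \<open>The weights total 0, so the single exceptional part has weight 0 as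
    well.\<close>
  have zero0: "sum (l C0) C0 = 0" if "C0 \<in> ?P"
    using dep(1) zero that sum.remove[of ?P C0 "\<lambda>C. sum (l C) C"] by simp
  show "\<forall>C\<in>?P. u C = 0"
  proof
    fix C assume C: "C \<in> ?P"
    then have "sum (l C) C = 0" using zero zero0 by blast
    then have "comb (l C) C \<bullet> comb (l C) C = 0" using dep(3)[OF C] by simp
    then show "u C = 0" using l[OF C] by simp
  qed
qed simp

lemma card_F: "card F = (\<Sum>C\<in>cocomponents F. card C)"
proof -
  have "card (\<Union>(cocomponents F)) = (\<Sum>C\<in>cocomponents F. card C)"
    using cocomponents_partition(3) by (rule card_Union_partition)
  then show ?thesis using cocomponents_partition(1) by metis
qed

lemma R_few_balanced:
  assumes "card (balanced_cocomponents F) \<le> 1"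
  shows "R s F = (\<Sum>C\<in>cocomponents F. R s C)"
proof -
  let ?P = "cocomponents F"
  \<comment> \<open>If nothing is balanced, \<open>C0\<close> is arbitrary.\<close>
  obtain C0 where "balanced_cocomponents F \<subseteq> {C0}"
    using assms by (metis card_le_Suc0_iff_eq finite One_nat_def insertI1 subsetI singletonI)
  then have "dim (\<Union>C\<in>?P. incidence_vec ` C) = (\<Sum>C\<in>?P. dim (incidence_vec ` C))"
    by (intro dim_reduced[of "\<lambda>C. C" C0]) auto
  moreover have "(\<Union>C\<in>?P. incidence_vec ` C) = incidence_vec ` F"
    using cocomponents_partition(1) by (metis image_Union)
  ultimately show ?thesis
    by (simp add: R_def rank_incidence_matrix sum_subtractf sum_distrib_left card_F)
qed

text \<open>An exchange step: \<open>e\<close> is an edge of nonzero weight in the center, and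
  independence of \<open>C\<close> makes that weight unique.\<close>

lemma balanced_removable_edge:
  assumes B: "C \<in> balanced_cocomponents F"
  obtains e where "e \<in> C" "center F C \<notin> span (incidence_vec ` (C - {e}))"
    "incidence_vec e \<in> span (insert (center F C) (incidence_vec ` (C - {e})))"
proof -
  obtain a where ind: "independent_edges C" and a: "nonneg_dual a C" "sum a C = 1"
    "center F C = comb a C"
    using balanced_weights[OF B] by metis
  then obtain e where e: "e \<in> C" "a e \<noteq> 0" by (metis sum.neutral zero_neq_one)
  have "C = insert e (C - {e})" using e by blast
  then have split: "comb l C = l e *\<^sub>R incidence_vec e + comb l (C - {e})" for l
    using comb_Un[of "{e}" "C - {e}" l] by (simp add: comb_def insert_absorb)
  have "center F C \<notin> span (incidence_vec ` (C - {e}))"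
  proof
    assume "center F C \<in> span (incidence_vec ` (C - {e}))"
    then obtain m where "comb a C = comb m (C - {e})" unfolding span_incidence a(3) by blast
    also have "\<dots> = comb (\<lambda>f. if f \<in> C - {e} then m f else 0) C" by (rule comb_subset[symmetric]) blast
    finally have "comb (\<lambda>f. a f - (if f \<in> C - {e} then m f else 0)) C = 0" by (simp add: comb_diff)
    then have "a e - (if e \<in> C - {e} then m e else 0) = 0"
      using ind e(1) unfolding independent_edges_def by fast
    then show False using e(2) by simp
  qed
  moreover have "incidence_vec e \<in> span (insert (center F C) (incidence_vec ` (C - {e})))"
  proof -
    have "incidence_vec e = (1 / a e) *\<^sub>R (center F C - comb a (C - {e}))"
      using e(2) by (simp add: a(3) split)
    moreover have "comb a (C - {e}) \<in> span (incidence_vec ` (C - {e}))"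
      by (simp add: span_incidence)
    then have "comb a (C - {e}) \<in> span (insert (center F C) (incidence_vec ` (C - {e})))"
      using span_mono[of "incidence_vec ` (C - {e})"] by blast
    ultimately show ?thesis by (simp add: span_scale span_diff span_base)
  qed
  ultimately show ?thesis using that e(1) by blast
qed

text \<open>Keep \<open>C0\<close> whole and drop one edge from every other balanced co-component.
  The common center lies in the span of \<open>C0\<close> and restores the dropped edges, so the
  rank is that of the reduced family, where dimensions add up.\<close>

lemma R_many_balanced:
  assumes z: "card (balanced_cocomponents F) \<ge> 2"
  shows "R s F = (\<Sum>C\<in>cocomponents F - balanced_cocomponents F. R s C) + J s F"
proof -
  let ?P = "cocomponents F" and ?B = "balanced_cocomponents F"
  let ?x = "\<lambda>A. incidence_vec ` A"
  have BP: "?B \<subseteq> ?P" using balanced_cocomponent by blast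
  obtain C0 where C0: "C0 \<in> ?B" using z by fastforce
  have "\<forall>C\<in>?B. \<exists>e. e \<in> C \<and> center F C \<notin> span (?x (C - {e})) \<and>
      incidence_vec e \<in> span (insert (center F C) (?x (C - {e})))"
    using balanced_removable_edge by metis
  then obtain d where d: "\<And>C. C \<in> ?B \<Longrightarrow> d C \<in> C"
    "\<And>C. C \<in> ?B \<Longrightarrow> center F C \<notin> span (?x (C - {d C}))"
    "\<And>C. C \<in> ?B \<Longrightarrow> incidence_vec (d C) \<in> span (insert (center F C) (?x (C - {d C})))"
    by metis
  define G where "G C = (if C \<in> ?B - {C0} then C - {d C} else C)" for C
  have dimG: "dim (\<Union>C\<in>?P. ?x (G C)) = (\<Sum>C\<in>?P. dim (?x (G C)))"
    by (rule dim_reduced[of G C0]) (use d(2) in \<open>auto simp: G_def\<close>)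
  have "?x F \<subseteq> span (\<Union>C\<in>?P. ?x (G C))"
  proof
    fix x assume "x \<in> ?x F"
    then obtain C e where e: "x = incidence_vec e" "e \<in> C" and C: "C \<in> ?P"
      using cocomponents_partition(1)[of F] by blast
    show "x \<in> span (\<Union>C\<in>?P. ?x (G C))"
    proof (cases "e \<in> G C")
      case True
      then show ?thesis using e C by (intro span_base) blast
    next
      case False
      then have B: "C \<in> ?B" and ed: "e = d C" and "G C = C - {d C}"
        using e by (auto simp: G_def split: if_splits)
      obtain a where "center F C0 = comb a C0" using balanced_weights[OF C0] by metis
      then have "center F C \<in> span (?x C0)"
        unfolding center_balanced_eq[OF B C0] span_incidence by simp
      moreover have "?x C0 \<subseteq> (\<Union>C\<in>?P. ?x (G C))" using C0 BP by (auto simp: G_def)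
      ultimately have "center F C \<in> span (\<Union>C\<in>?P. ?x (G C))" using span_mono by blast
      moreover have "?x (C - {d C}) \<subseteq> span (\<Union>C\<in>?P. ?x (G C))"
        using C \<open>G C = C - {d C}\<close> by (intro subsetI span_base) (metis UN_I)
      ultimately have "insert (center F C) (?x (C - {d C})) \<subseteq> span (\<Union>C\<in>?P. ?x (G C))" by blast
      then have "span (insert (center F C) (?x (C - {d C}))) \<subseteq> span (\<Union>C\<in>?P. ?x (G C))"
        by (intro span_minimal) simp_all
      then show ?thesis using d(3)[OF B] e ed by blast
    qed
  qed
  then have "dim (?x F) \<le> dim (\<Union>C\<in>?P. ?x (G C))"
    by (metis dim_span dim_subset)
  moreover have "(\<Union>C\<in>?P. ?x (G C)) \<subseteq> ?x F"
    using cocomponent_subset by (fastforce simp: G_def split: if_splits)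
  then have "dim (\<Union>C\<in>?P. ?x (G C)) \<le> dim (?x F)" by (rule dim_subset)
  ultimately have "dim (?x F) = (\<Sum>C\<in>?P. dim (?x (G C)))" using dimG by simp
  also have "\<dots> = (\<Sum>C\<in>?P - ?B. dim (?x (G C))) + (\<Sum>C\<in>?B. dim (?x (G C)))"
    using BP by (simp add: sum.subset_diff)
  also have "(\<Sum>C\<in>?P - ?B. dim (?x (G C))) = (\<Sum>C\<in>?P - ?B. dim (?x C))"
    by (intro sum.cong) (auto simp: G_def)
  finally have dimF: "dim (?x F) = (\<Sum>C\<in>?P - ?B. dim (?x C)) + (\<Sum>C\<in>?B. dim (?x (G C)))" .
  have "int (dim (?x (G C))) = int (card C) - (if C = C0 then 0 else 1)" if C: "C \<in> ?B" for C
  proof -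
    have ind: "independent_edges C" using balanced_weights[OF C] by metis
    have "dim (?x (G C)) = card (G C)"
      using ind by (intro dim_independent_edges) (auto simp: G_def intro: independent_edges_subset)
    moreover have "int (card (C - {d C})) = int (card C) - 1"
      using card_Suc_Diff1[OF finite d(1)[OF C]] by simp
    ultimately show ?thesis using C by (simp add: G_def)
  qed
  then have "int (\<Sum>C\<in>?B. dim (?x (G C))) = (\<Sum>C\<in>?B. int (card C) - (if C = C0 then 0 else 1))"
    by simp
  also have "\<dots> = (\<Sum>C\<in>?B. int (card C)) - (int (card ?B) - 1)"
  proof -
    have "(\<Sum>C\<in>?B. if C = C0 then 0 else 1::int) = (\<Sum>C\<in>?B - {C0}. 1)"
      using C0 by (intro sum.mono_neutral_cong_right) auto
    also have "\<dots> = int (card ?B) - 1"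
      using C0 z by (simp add: card_Diff_singleton of_nat_diff)
    finally show ?thesis by (simp add: sum_subtractf)
  qed
  finally have dimB: "int (\<Sum>C\<in>?B. dim (?x (G C))) = (\<Sum>C\<in>?B. int (card C)) - (int (card ?B) - 1)" .
  have cardF: "int (card F) = (\<Sum>C\<in>?P - ?B. int (card C)) + (\<Sum>C\<in>?B. int (card C))"
    using BP by (simp add: card_F sum.subset_diff)
  have "int (dim (?x F)) = (\<Sum>C\<in>?P - ?B. int (dim (?x C))) +
      ((\<Sum>C\<in>?B. int (card C)) - (int (card ?B) - 1))"
    unfolding dimF using dimB by simp
  \<comment> \<open>With \<open>M\<close> the number of edges in the \<open>z\<close> balanced
    co-components, their share is \<open>(s + 1) * (M - (z - 1)) - s * M\<close>, which is
    \<open>J s F\<close>.\<close>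
  from arg_cong[OF this, of "\<lambda>t. (int s + 1) * t"] show ?thesis
    unfolding R_def J_def rank_incidence_matrix cardF sum_subtractf sum_distrib_left[symmetric]
    by (simp add: algebra_simps)
qed

lemma J_eq: "J s F = int s + 1 - int (card (balanced_cocomponents F)) +
    (\<Sum>C\<in>balanced_cocomponents F. int (card C) - int s)"
  by (simp add: J_def sum_subtractf algebra_simps)

text \<open>A balanced co-component with more than \<open>s\<close> edges contributes at least 1 to
  the sum in \<open>J_eq\<close>, offsetting its share of the subtracted count.\<close>

lemma J_ge:
  "J s F \<ge> int s + 1 - int (card {C \<in> balanced_cocomponents F. card C = s})"
proof -
  let ?B = "balanced_cocomponents F"
  have "(\<Sum>C\<in>?B. if card C = s then 0 else 1) \<le> (\<Sum>C\<in>?B. int (card C) - int s)"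
  proof (rule sum_mono)
    fix C assume "C \<in> ?B"
    then show "(if card C = s then 0 else 1) \<le> int (card C) - int s"
      using balanced_card_ge[of C] by auto
  qed
  moreover have "(\<Sum>C\<in>?B. if card C = s then 0 else 1::int) = int (card {C \<in> ?B. card C \<noteq> s})"
    by (simp add: sum.If_cases Int_def)
  moreover have "card ?B = card {C \<in> ?B. card C = s} + card {C \<in> ?B. card C \<noteq> s}"
    by (subst card_Un_disjoint[symmetric]) (auto intro: arg_cong[of _ _ card])
  ultimately show ?thesis unfolding J_eq by simp
qed

end

theorem lemma4p1:
  fixes s :: nat and F :: "'v::finite set set"
  assumes "s \<ge> 2"
    and "uniform_hypergraph s F"
    and "linear_hypergraph F"
    and "cograph F (line_graph F)"
  shows
      "(graph_connected F (line_graph F) \<and> card F \<ge> 2 \<longrightarrow>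
        (let B = balanced_cocomponents F;
             z = card B;
             a = card {C \<in> B. card C = s}
         in card (cocomponents F) \<ge> 2 \<and>
            R s F =
              (if z \<le> 1 then \<Sum>C\<in>cocomponents F. R s C
               else (\<Sum>C\<in>cocomponents F - B. R s C) + J s F) \<and>
            J s F = int s + 1 - int z + (\<Sum>C\<in>B. int (card C) - int s) \<and>
            J s F \<ge> int s + 1 - int a \<and>
            int s + 1 - int a \<ge> 0)) \<and>
       (\<not> graph_connected F (line_graph F) \<longrightarrow>
        R s F = (\<Sum>C\<in>line_components F. R s C))"
proof -
  interpret linear_cograph s F using assms by unfold_locales
  have "R s F = (if card (balanced_cocomponents F) \<le> 1 then \<Sum>C\<in>cocomponents F. R s C
      else (\<Sum>C\<in>cocomponents F - balanced_cocomponents F. R s C) + J s F)"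
    using R_few_balanced R_many_balanced by simp
  moreover have "int s + 1 - int (card {C \<in> balanced_cocomponents F. card C = s}) \<ge> 0"
    using card_balanced_small by linarith
  ultimately show ?thesis
    unfolding Let_def using card_cocomponents_ge_2 J_eq J_ge R_line_components by blast
qed

end
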